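(* Let $\Omega$ be a (possibly infinite) set and let $G\leq \mathrm{Sym}(\Omega)$ be a quasiprimitive permutation group of simple diagonal type acting on $\Omega$. Then $G$ is not contained in any subgroup of $\mathrm{Sym}(\Omega)$ that is permutationally isomorphic to $\mathrm{Sym}(\Gamma)\wr S_\ell$ acting in its product action on $\Gamma^\ell$, where $\Gamma$ is a set with $|\Gamma|\geq 2$ and $\ell\geq 2$ is an integer.
   Context: Groups and sets may be infinite. Permutations act on the right. A permutation group $G\leq\mathrm{Sym}(\Omega)$ is quasiprimitive if all its non-trivial normal subgroups are transitive on $\Omega$. A characteristically simple group $M$ is finitely completely reducible (FCR) if it is isomorphic to $T^k$ for some simple group $T$ and some integer $k\geq 1$. A subgroup $H$ of a direct product $M=T_1\times\cdots\times T_k$ with coordinate projections $\sigma_i:M\to T_i$ is subdirect if $H\sigma_i=T_i$ for all $i$. A quasiprimitive group $G\leq \mathrm{Sym}(\Omega)$ is of diagonal type if it has a unique minimal normal FCR subgroup $M$ such that $M=T_1\times\cdots\times T_k$, where the $T_i$ are non-abelian simple groups, and a point stabiliser $M_\omega$ ($\omega\in\Omega$) is a subdirect subgroup of $M$. It is of simple diagonal type if, in addition, $M_\omega$ is a simple group. For a set $\Gamma$ and an integer $\ell\geq 2$, with $S_\ell$ the symmetric group on $\{1,\ldots,\ell\}$, the product action of $\mathrm{Sym}(\Gamma)\wr S_\ell=\mathrm{Sym}(\Gamma)^\ell\rtimes S_\ell$ on $\Gamma^\ell$ is defined by $$(\gamma_1,\ldots,\gamma_\ell)(g_1,\ldots,g_\ell)\sigma=(\gamma_{1\sigma^{-1}}g_{1\sigma^{-1}},\ldots,\gamma_{\ell\sigma^{-1}}g_{\ell\sigma^{-1}})$$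 for $\gamma_i\in\Gamma$, $g_i\in\mathrm{Sym}(\Gamma)$, $\sigma\in S_\ell$. Permutation groups $A\leq\mathrm{Sym}(\Omega)$ and $B\leq\mathrm{Sym}(\Delta)$ are permutationally isomorphic if there are a bijection $f:\Omega\to\Delta$ and a group isomorphism $\varphi:A\to B$ such that $(\omega a)f=(\omega f)(a\varphi)$ for all $\omega\in\Omega$, $a\in A$. *)

theory Defs
  imports "HOL-Algebra.Group_Action" "HOL-Algebra.Product_Groups" "HOL-Algebra.Sym_Groups"
begin

text \<open>
  Sym(\<Omega>) is \<^term>\<open>BijGroup \<Omega>\<close>, and a permutation group on \<Omega> is the set of its elements, viewed as
  a group by restricting the carrier. The image of a point \<omega> under a permutation g, written on the
  right in the literature, is the application \<open>g \<omega>\<close>. The product of \<^term>\<open>BijGroup \<Omega>\<close> composes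
  from right to left, so it is the opposite of the product of the right-action convention. Every
  notion below is invariant under passing to opposite groups.
\<close>

abbreviation perm_group :: "'a set \<Rightarrow> ('a \<Rightarrow> 'a) set \<Rightarrow> ('a \<Rightarrow> 'a) monoid"
  where "perm_group \<Omega> G \<equiv> (BijGroup \<Omega>)\<lparr>carrier := G\<rparr>"

abbreviation transitive_on :: "'a set \<Rightarrow> ('a \<Rightarrow> 'a) set \<Rightarrow> bool"
  where "transitive_on \<Omega> N \<equiv> transitive_action (perm_group \<Omega> N) \<Omega> (\<lambda>g. g)"

abbreviation point_stabilizer :: "'a set \<Rightarrow> ('a \<Rightarrow> 'a) set \<Rightarrow> 'a \<Rightarrow> ('a \<Rightarrow> 'a) set"
  where "point_stabilizer \<Omega> M \<omega> \<equiv> stabilizer (perm_group \<Omega> M) (\<lambda>g. g) \<omega>"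

definition quasiprimitive :: "'a set \<Rightarrow> ('a \<Rightarrow> 'a) set \<Rightarrow> bool"
  where "quasiprimitive \<Omega> G \<longleftrightarrow>
    subgroup G (BijGroup \<Omega>) \<and>
    (\<forall>N. N \<lhd> perm_group \<Omega> G \<longrightarrow> N \<noteq> {\<one>\<^bsub>BijGroup \<Omega>\<^esub>} \<longrightarrow> transitive_on \<Omega> N)"

text \<open>
  The locale \<open>simple_group\<close> of the library requires \<open>order G > 1\<close> with \<open>order\<close> defined through
  \<open>card\<close>, so it excludes infinite simple groups.
\<close>

definition is_simple :: "('a, 'b) monoid_scheme \<Rightarrow> bool"
  where "is_simple G \<longleftrightarrow>
    group G \<and> carrier G \<noteq> {\<one>\<^bsub>G\<^esub>} \<and> (\<forall>N. N \<lhd> G \<longrightarrow> N = {\<one>\<^bsub>G\<^esub>} \<or> N = carrier G)"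

definition characteristic :: "'a set \<Rightarrow> ('a, 'b) monoid_scheme \<Rightarrow> bool"
  where "characteristic H G \<longleftrightarrow> subgroup H G \<and> (\<forall>\<phi> \<in> iso G G. \<phi> ` H = H)"

definition characteristically_simple :: "('a, 'b) monoid_scheme \<Rightarrow> bool"
  where "characteristically_simple G \<longleftrightarrow>
    group G \<and> carrier G \<noteq> {\<one>\<^bsub>G\<^esub>} \<and>
    (\<forall>H. characteristic H G \<longrightarrow> H = {\<one>\<^bsub>G\<^esub>} \<or> H = carrier G)"

text \<open>
  Letting T range over groups on the element type of M is no restriction: if M is isomorphic to a
  power of T with positive exponent, then M contains an isomorphic copy of T.
\<close>

definition FCR :: "('a, 'b) monoid_scheme \<Rightarrow> bool"
  where "FCR M \<longleftrightarrow>
    characteristically_simple M \<and>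
    (\<exists>(T :: 'a monoid) (k :: nat). k \<ge> 1 \<and> is_simple T \<and> M \<cong> product_group {1..k} (\<lambda>_. T))"

definition subdirect :: "'i set \<Rightarrow> ('i \<Rightarrow> ('a, 'b) monoid_scheme) \<Rightarrow> ('i \<Rightarrow> 'a) set \<Rightarrow> bool"
  where "subdirect I T H \<longleftrightarrow>
    subgroup H (product_group I T) \<and> (\<forall>i \<in> I. (\<lambda>x. x i) ` H = carrier (T i))"

definition minimal_normal :: "'a set \<Rightarrow> ('a, 'b) monoid_scheme \<Rightarrow> bool"
  where "minimal_normal N G \<longleftrightarrow>
    N \<lhd> G \<and> N \<noteq> {\<one>\<^bsub>G\<^esub>} \<and> (\<forall>K. K \<lhd> G \<longrightarrow> K \<subseteq> N \<longrightarrow> K = {\<one>\<^bsub>G\<^esub>} \<or> K = N)"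

text \<open>
  \<open>diagonal_type_at \<Omega> G M \<omega>\<close>: G is of diagonal type, with M and \<omega> the minimal normal subgroup and
  the point named in the definition. The isomorphism h identifies M with the direct product
  of the groups \<open>T 1, \<dots>, T k\<close>.
\<close>

definition diagonal_type_at ::
    "'a set \<Rightarrow> ('a \<Rightarrow> 'a) set \<Rightarrow> ('a \<Rightarrow> 'a) set \<Rightarrow> 'a \<Rightarrow> bool"
  where "diagonal_type_at \<Omega> G M \<omega> \<longleftrightarrow>
    quasiprimitive \<Omega> G \<and>
    minimal_normal M (perm_group \<Omega> G) \<and> FCR (perm_group \<Omega> M) \<and>
    (\<forall>N. minimal_normal N (perm_group \<Omega> G) \<and> FCR (perm_group \<Omega> N) \<longrightarrow> N = M) \<and>
    \<omega> \<in> \<Omega> \<and>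
    (\<exists>(k :: nat) (T :: nat \<Rightarrow> ('a \<Rightarrow> 'a) monoid) h.
      k \<ge> 1 \<and>
      (\<forall>i \<in> {1..k}. is_simple (T i) \<and> \<not> comm_group (T i)) \<and>
      h \<in> iso (perm_group \<Omega> M) (product_group {1..k} T) \<and>
      subdirect {1..k} T (h ` point_stabilizer \<Omega> M \<omega>))"

definition diagonal_type :: "'a set \<Rightarrow> ('a \<Rightarrow> 'a) set \<Rightarrow> bool"
  where "diagonal_type \<Omega> G \<longleftrightarrow> (\<exists>M \<omega>. diagonal_type_at \<Omega> G M \<omega>)"

definition simple_diagonal_type :: "'a set \<Rightarrow> ('a \<Rightarrow> 'a) set \<Rightarrow> bool"
  where "simple_diagonal_type \<Omega> G \<longleftrightarrow>
    (\<exists>M \<omega>. diagonal_type_at \<Omega> G M \<omega> \<and>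
      is_simple (perm_group \<Omega> (point_stabilizer \<Omega> M \<omega>)))"

abbreviation (input) cartesian_power :: "'b set \<Rightarrow> nat \<Rightarrow> (nat \<Rightarrow> 'b) set"
  where "cartesian_power \<Gamma> l \<equiv> {1..l} \<rightarrow>\<^sub>E \<Gamma>"

text \<open>The permutation of the l-th power of \<Gamma> induced by the element \<open>(g 1, \<dots>, g l)\<sigma>\<close> of the wreath
  product.\<close>

definition product_action ::
    "'b set \<Rightarrow> nat \<Rightarrow> (nat \<Rightarrow> 'b \<Rightarrow> 'b) \<Rightarrow> (nat \<Rightarrow> nat) \<Rightarrow> (nat \<Rightarrow> 'b) \<Rightarrow> (nat \<Rightarrow> 'b)"
  where "product_action \<Gamma> l g \<sigma> =
    (\<lambda>\<gamma> \<in> cartesian_power \<Gamma> l. \<lambda>i \<in> {1..l}. g (inv' \<sigma> i) (\<gamma> (inv' \<sigma> i)))"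

text \<open>
  The wreath product of Sym(\<Gamma>) and \<open>S\<^sub>l\<close> in product action, as a permutation group on the l-th power
  of \<Gamma>. By \<open>product_action_faithful\<close> below, the action is faithful when \<Gamma> has at least two elements.
\<close>

definition wreath_product_action :: "'b set \<Rightarrow> nat \<Rightarrow> ((nat \<Rightarrow> 'b) \<Rightarrow> (nat \<Rightarrow> 'b)) set"
  where "wreath_product_action \<Gamma> l =
    {product_action \<Gamma> l g \<sigma> | g \<sigma>.
      g \<in> carrier (product_group {1..l} (\<lambda>_. BijGroup \<Gamma>)) \<and> \<sigma> \<in> carrier (sym_group l)}"

definition perm_isomorphic ::
    "'a set \<Rightarrow> ('a \<Rightarrow> 'a) set \<Rightarrow> 'b set \<Rightarrow> ('b \<Rightarrow> 'b) set \<Rightarrow> bool"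
  where "perm_isomorphic \<Omega> A \<Delta> B \<longleftrightarrow>
    subgroup A (BijGroup \<Omega>) \<and> subgroup B (BijGroup \<Delta>) \<and>
    (\<exists>f \<phi>. bij_betw f \<Omega> \<Delta> \<and> \<phi> \<in> iso (perm_group \<Omega> A) (perm_group \<Delta> B) \<and>
      (\<forall>\<omega> \<in> \<Omega>. \<forall>a \<in> A. f (a \<omega>) = \<phi> a (f \<omega>)))"

lemma Bij_in: "g \<in> Bij S \<Longrightarrow> x \<in> S \<Longrightarrow> g x \<in> S"
  using Bij_imp_funcset by auto

lemma sym_group_in:
  assumes "\<sigma> \<in> carrier (sym_group l)"
  shows "inv' \<sigma> \<in> carrier (sym_group l)" "i \<in> {1..l} \<Longrightarrow> \<sigma> i \<in> {1..l}"
    "\<sigma> (inv' \<sigma> i) = i" "inv' \<sigma> (\<sigma> i) = i" "inv' (inv' \<sigma>) = \<sigma>"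
  using assms permutes_inv[of \<sigma> "{1..l}"] permutes_in_image[of \<sigma> "{1..l}"]
    permutes_inverses[of \<sigma> "{1..l}"] permutes_inv_inv[of \<sigma> "{1..l}"]
  by (auto simp: sym_group_carrier)

lemma product_action_closed:
  assumes g: "g \<in> {1..l} \<rightarrow>\<^sub>E Bij \<Gamma>" and s: "\<sigma> \<in> carrier (sym_group l)"
    and x: "\<gamma> \<in> cartesian_power \<Gamma> l"
  shows "product_action \<Gamma> l g \<sigma> \<gamma> \<in> cartesian_power \<Gamma> l"
proof -
  have "g (inv' \<sigma> i) (\<gamma> (inv' \<sigma> i)) \<in> \<Gamma>" if "i \<in> {1..l}" for i
  proof -
    have j: "inv' \<sigma> i \<in> {1..l}" using sym_group_in(2)[OF sym_group_in(1)[OF s] that] .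
    show ?thesis by (rule Bij_in[OF PiE_mem[OF g j] PiE_mem[OF x j]])
  qed
  then have "(\<lambda>i \<in> {1..l}. g (inv' \<sigma> i) (\<gamma> (inv' \<sigma> i))) \<in> cartesian_power \<Gamma> l"
    by (intro restrict_PiE_iff[THEN iffD2] ballI)
  then show ?thesis unfolding product_action_def restrict_apply'[OF x] .
qed

lemma product_action_compose:
  assumes g: "g \<in> {1..l} \<rightarrow>\<^sub>E Bij \<Gamma>" and h: "h \<in> {1..l} \<rightarrow>\<^sub>E Bij \<Gamma>"
    and s: "\<sigma> \<in> carrier (sym_group l)" and t: "\<tau> \<in> carrier (sym_group l)"
  shows "compose (cartesian_power \<Gamma> l) (product_action \<Gamma> l h \<tau>) (product_action \<Gamma> l g \<sigma>) =
    product_action \<Gamma> l (\<lambda>j \<in> {1..l}. compose \<Gamma> (h (\<sigma> j)) (g j)) (\<tau> \<circ> \<sigma>)"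
proof
  fix \<gamma>
  show "compose (cartesian_power \<Gamma> l) (product_action \<Gamma> l h \<tau>) (product_action \<Gamma> l g \<sigma>) \<gamma> =
    product_action \<Gamma> l (\<lambda>j \<in> {1..l}. compose \<Gamma> (h (\<sigma> j)) (g j)) (\<tau> \<circ> \<sigma>) \<gamma>"
  proof (cases "\<gamma> \<in> cartesian_power \<Gamma> l")
    case True
    have bs: "bij \<sigma>" "bij \<tau>"
      using s t by (auto simp: sym_group_carrier permutes_bij)
    have in1: "inv' \<tau> i \<in> {1..l}" and in2: "inv' \<sigma> (inv' \<tau> i) \<in> {1..l}" if "i \<in> {1..l}" for i
      using that sym_group_in(2)[OF sym_group_in(1)[OF t]] sym_group_in(2)[OF sym_group_in(1)[OF s]]
      by blast+
    have gm: "\<gamma> (inv' \<sigma> (inv' \<tau> i)) \<in> \<Gamma>" if "i \<in> {1..l}" for i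
      by (rule PiE_mem[OF True in2[OF that]])
    have "product_action \<Gamma> l h \<tau> (product_action \<Gamma> l g \<sigma> \<gamma>) =
      product_action \<Gamma> l (\<lambda>j \<in> {1..l}. compose \<Gamma> (h (\<sigma> j)) (g j)) (\<tau> \<circ> \<sigma>) \<gamma>"
      using True product_action_closed[OF g s True] in1 in2 gm sym_group_in(3)[OF s]
      by (auto simp: product_action_def o_inv_distrib[OF bs(2,1)] compose_def
          simp del: atLeastAtMost_iff intro!: restrict_ext)
    then show ?thesis using True by (simp add: compose_def)
  qed (simp add: compose_def product_action_def)
qed

lemma product_action_one:
  "product_action \<Gamma> l (\<lambda>i \<in> {1..l}. \<lambda>x \<in> \<Gamma>. x) id = (\<lambda>\<gamma> \<in> cartesian_power \<Gamma> l. \<gamma>)"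
  by (rule ext) (auto simp: product_action_def PiE_iff extensional_def fun_eq_iff)

lemma product_action_left_inverse:
  assumes g: "g \<in> {1..l} \<rightarrow>\<^sub>E Bij \<Gamma>" and s: "\<sigma> \<in> carrier (sym_group l)"
  obtains h where "h \<in> {1..l} \<rightarrow>\<^sub>E Bij \<Gamma>"
    "compose (cartesian_power \<Gamma> l) (product_action \<Gamma> l h (inv' \<sigma>)) (product_action \<Gamma> l g \<sigma>) =
      (\<lambda>\<gamma> \<in> cartesian_power \<Gamma> l. \<gamma>)"
proof
  let ?h = "\<lambda>j \<in> {1..l}. restrict (inv_into \<Gamma> (g (inv' \<sigma> j))) \<Gamma>"
  have gB: "g j \<in> Bij \<Gamma>" if "j \<in> {1..l}" for j using g that by (rule PiE_mem)
  have in1: "inv' \<sigma> i \<in> {1..l}" if "i \<in> {1..l}" for i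
    using that sym_group_in(2)[OF sym_group_in(1)[OF s]] by blast
  show h: "?h \<in> {1..l} \<rightarrow>\<^sub>E Bij \<Gamma>"
  proof (rule restrict_PiE_iff[THEN iffD2], intro ballI)
    fix i assume "i \<in> {1..l}"
    then show "restrict (inv_into \<Gamma> (g (inv' \<sigma> i))) \<Gamma> \<in> Bij \<Gamma>"
      using restrict_inv_into_Bij[OF gB[OF in1]] by simp
  qed
  have "(\<lambda>j \<in> {1..l}. compose \<Gamma> (?h (\<sigma> j)) (g j)) = (\<lambda>i \<in> {1..l}. \<lambda>x \<in> \<Gamma>. x)"
    using sym_group_in(2,4)[OF s] Bij_compose_restrict_eq[OF gB]
    by (intro restrict_ext) (simp del: atLeastAtMost_iff)
  moreover have "inv' \<sigma> \<circ> \<sigma> = id" using sym_group_in(4)[OF s] by (auto simp: fun_eq_iff)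
  ultimately show "compose (cartesian_power \<Gamma> l) (product_action \<Gamma> l ?h (inv' \<sigma>))
      (product_action \<Gamma> l g \<sigma>) = (\<lambda>\<gamma> \<in> cartesian_power \<Gamma> l. \<gamma>)"
    unfolding product_action_compose[OF g h s sym_group_in(1)[OF s]]
    by (simp only: product_action_one)
qed

lemma product_action_Bij:
  assumes g: "g \<in> {1..l} \<rightarrow>\<^sub>E Bij \<Gamma>" and s: "\<sigma> \<in> carrier (sym_group l)"
  shows "product_action \<Gamma> l g \<sigma> \<in> Bij (cartesian_power \<Gamma> l)"
proof -
  let ?P = "cartesian_power \<Gamma> l"
  let ?a = "product_action \<Gamma> l g \<sigma>"
  obtain h where h: "h \<in> {1..l} \<rightarrow>\<^sub>E Bij \<Gamma>"
    and ha: "compose ?P (product_action \<Gamma> l h (inv' \<sigma>)) ?a = (\<lambda>\<gamma> \<in> ?P. \<gamma>)"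
    using product_action_left_inverse[OF g s] .
  let ?b = "product_action \<Gamma> l h (inv' \<sigma>)"
  have s': "inv' \<sigma> \<in> carrier (sym_group l)" using sym_group_in(1)[OF s] .
  obtain k where k: "k \<in> {1..l} \<rightarrow>\<^sub>E Bij \<Gamma>"
    and kb: "compose ?P (product_action \<Gamma> l k \<sigma>) ?b = (\<lambda>\<gamma> \<in> ?P. \<gamma>)"
    using product_action_left_inverse[OF h s'] sym_group_in(5)[OF s] by metis
  have ba: "?b (?a x) = x" if "x \<in> ?P" for x
    using fun_cong[OF ha, of x] that by (simp add: compose_def)
  have cb: "product_action \<Gamma> l k \<sigma> (?b x) = x" if "x \<in> ?P" for x
    using fun_cong[OF kb, of x] that by (simp add: compose_def)
  have aP: "?a x \<in> ?P" "?b x \<in> ?P" if "x \<in> ?P" for x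
    using product_action_closed[OF g s that] product_action_closed[OF h s' that] .
  have ab: "?a (?b x) = x" if "x \<in> ?P" for x
    using ba cb aP that by metis
  have "bij_betw ?a ?P ?P"
    by (rule bij_betw_byWitness[where f' = ?b]) (use ab ba aP in blast)+
  then show ?thesis by (simp add: Bij_def product_action_def)
qed

lemma subgroup_wreath_product_action:
  "subgroup (wreath_product_action \<Gamma> l) (BijGroup (cartesian_power \<Gamma> l))"
proof -
  let ?P = "cartesian_power \<Gamma> l" and ?W = "wreath_product_action \<Gamma> l"
  have oB: "\<one>\<^bsub>BijGroup ?P\<^esub> = (\<lambda>x \<in> ?P. x)" and cB': "carrier (BijGroup ?P) = Bij ?P"
    by (simp_all add: BijGroup_def)
  have mB: "x \<otimes>\<^bsub>BijGroup ?P\<^esub> y = compose ?P x y" if "x \<in> Bij ?P" "y \<in> Bij ?P" for x y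
    using that by (simp add: BijGroup_def)
  have W: "a \<in> ?W \<longleftrightarrow> (\<exists>g \<sigma>. a = product_action \<Gamma> l g \<sigma> \<and> g \<in> {1..l} \<rightarrow>\<^sub>E Bij \<Gamma> \<and>
      \<sigma> \<in> carrier (sym_group l))" for a
    by (simp add: wreath_product_action_def BijGroup_def)
  have sub: "?W \<subseteq> Bij ?P"
  proof
    fix a assume "a \<in> ?W"
    then obtain g \<sigma> where "a = product_action \<Gamma> l g \<sigma>" "g \<in> {1..l} \<rightarrow>\<^sub>E Bij \<Gamma>"
      "\<sigma> \<in> carrier (sym_group l)" unfolding W by (elim exE conjE)
    then show "a \<in> Bij ?P" by (simp only: product_action_Bij)
  qed
  have WI: "product_action \<Gamma> l g \<sigma> \<in> ?W"
    if "g \<in> {1..l} \<rightarrow>\<^sub>E Bij \<Gamma>" "\<sigma> \<in> carrier (sym_group l)" for g \<sigma>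
    unfolding W by (rule exI[where x = g], rule exI[where x = \<sigma>]) (simp only: that simp_thms)
  have WE: thesis if "a \<in> ?W" "\<And>g \<sigma>. a = product_action \<Gamma> l g \<sigma> \<Longrightarrow>
      g \<in> {1..l} \<rightarrow>\<^sub>E Bij \<Gamma> \<Longrightarrow> \<sigma> \<in> carrier (sym_group l) \<Longrightarrow> thesis" for a thesis
    using that(1) unfolding W by (elim exE conjE) (rule that(2))
  have one: "\<one>\<^bsub>BijGroup ?P\<^esub> \<in> ?W"
    unfolding oB product_action_one[symmetric]
  proof (rule WI)
    show "(\<lambda>i \<in> {1..l}. \<lambda>x \<in> \<Gamma>. x) \<in> {1..l} \<rightarrow>\<^sub>E Bij \<Gamma>"
      by (intro restrict_PiE_iff[THEN iffD2] ballI id_Bij)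
    show "id \<in> carrier (sym_group l)" by (simp add: sym_group_carrier permutes_id)
  qed
  have mult: "a \<otimes>\<^bsub>BijGroup ?P\<^esub> b \<in> ?W" if a: "a \<in> ?W" and b: "b \<in> ?W" for a b
  proof -
    obtain h \<tau> where h: "a = product_action \<Gamma> l h \<tau>" "h \<in> {1..l} \<rightarrow>\<^sub>E Bij \<Gamma>" "\<tau> \<in> carrier (sym_group l)"
      by (rule WE[OF a])
    obtain g \<sigma> where g: "b = product_action \<Gamma> l g \<sigma>" "g \<in> {1..l} \<rightarrow>\<^sub>E Bij \<Gamma>" "\<sigma> \<in> carrier (sym_group l)"
      by (rule WE[OF b])
    have "compose \<Gamma> (h (\<sigma> j)) (g j) \<in> Bij \<Gamma>" if "j \<in> {1..l}" for j
      using compose_Bij[OF PiE_mem[OF h(2) sym_group_in(2)[OF g(3) that]] PiE_mem[OF g(2) that]] .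
    then have "(\<lambda>j \<in> {1..l}. compose \<Gamma> (h (\<sigma> j)) (g j)) \<in> {1..l} \<rightarrow>\<^sub>E Bij \<Gamma>"
      by (intro restrict_PiE_iff[THEN iffD2] ballI)
    moreover have "\<tau> \<circ> \<sigma> \<in> carrier (sym_group l)"
      using g(3) h(3) by (simp add: sym_group_carrier permutes_compose)
    ultimately have "compose ?P a b \<in> ?W"
      unfolding h(1) g(1) product_action_compose[OF g(2) h(2) g(3) h(3)] by (rule WI)
    then show ?thesis unfolding mB[OF subsetD[OF sub a] subsetD[OF sub b]] .
  qed
  have minv: "inv\<^bsub>BijGroup ?P\<^esub> a \<in> ?W" if a: "a \<in> ?W" for a
  proof -
    obtain g \<sigma> where g: "a = product_action \<Gamma> l g \<sigma>" "g \<in> {1..l} \<rightarrow>\<^sub>E Bij \<Gamma>" "\<sigma> \<in> carrier (sym_group l)"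
      by (rule WE[OF a])
    obtain h where h: "h \<in> {1..l} \<rightarrow>\<^sub>E Bij \<Gamma>"
      "compose ?P (product_action \<Gamma> l h (inv' \<sigma>)) a = (\<lambda>\<gamma> \<in> ?P. \<gamma>)"
      unfolding g(1) by (rule product_action_left_inverse[OF g(2,3)])
    have bW: "product_action \<Gamma> l h (inv' \<sigma>) \<in> ?W"
      by (rule WI[OF h(1) sym_group_in(1)[OF g(3)]])
    have "product_action \<Gamma> l h (inv' \<sigma>) \<otimes>\<^bsub>BijGroup ?P\<^esub> a = \<one>\<^bsub>BijGroup ?P\<^esub>"
      unfolding mB[OF subsetD[OF sub bW] subsetD[OF sub a]] h(2) oB ..
    then have "inv\<^bsub>BijGroup ?P\<^esub> a = product_action \<Gamma> l h (inv' \<sigma>)"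
      by (rule group.inv_equality[OF group_BijGroup])
        (simp_all only: cB' subsetD[OF sub bW] subsetD[OF sub a])
    then show ?thesis using bW by simp
  qed
  show ?thesis
  proof (rule group.subgroupI[OF group_BijGroup])
    show "?W \<subseteq> carrier (BijGroup ?P)" unfolding cB' by (rule sub)
    show "?W \<noteq> {}" using one by blast
  qed (fact minv mult)+
qed

lemma product_action_faithful:
  assumes "x \<in> \<Gamma>" "y \<in> \<Gamma>" "x \<noteq> y"
  shows "inj_on (\<lambda>(g, \<sigma>). product_action \<Gamma> l g \<sigma>)
    (carrier (product_group {1..l} (\<lambda>_. BijGroup \<Gamma>)) \<times> carrier (sym_group l))"
proof (rule inj_onI)
  fix p q
  assume "p \<in> carrier (product_group {1..l} (\<lambda>_. BijGroup \<Gamma>)) \<times> carrier (sym_group l)"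
    "q \<in> carrier (product_group {1..l} (\<lambda>_. BijGroup \<Gamma>)) \<times> carrier (sym_group l)"
    "(case p of (g, \<sigma>) \<Rightarrow> product_action \<Gamma> l g \<sigma>) = (case q of (g, \<sigma>) \<Rightarrow> product_action \<Gamma> l g \<sigma>)"
  then obtain g \<sigma> h \<tau> where pq: "p = (g, \<sigma>)" "q = (h, \<tau>)" and 1: "g \<in> {1..l} \<rightarrow>\<^sub>E Bij \<Gamma>"
    "\<sigma> \<in> carrier (sym_group l)" "h \<in> {1..l} \<rightarrow>\<^sub>E Bij \<Gamma>" "\<tau> \<in> carrier (sym_group l)"
    "product_action \<Gamma> l g \<sigma> = product_action \<Gamma> l h \<tau>"
    by (cases p; cases q) (simp add: BijGroup_def)
  let ?P = "cartesian_power \<Gamma> l"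
  have g: "g j \<in> Bij \<Gamma>" and h: "h j \<in> Bij \<Gamma>" if "j \<in> {1..l}" for j
    using PiE_mem[OF 1(1) that] PiE_mem[OF 1(3) that] .
  have eq: "g (inv' \<sigma> i) (\<gamma> (inv' \<sigma> i)) = h (inv' \<tau> i) (\<gamma> (inv' \<tau> i))"
    if "i \<in> {1..l}" "\<gamma> \<in> ?P" for i \<gamma>
    using fun_cong[OF fun_cong[OF 1(5), of \<gamma>], of i] that
    by (simp add: product_action_def)
  have in1: "inv' \<sigma> i \<in> {1..l}" if "i \<in> {1..l}" for i
    using that sym_group_in(2)[OF sym_group_in(1)[OF 1(2)]] by blast
  have inv: "inv' \<sigma> i = inv' \<tau> i" if i: "i \<in> {1..l}" for i
  proof (rule ccontr)
    assume ne: "inv' \<sigma> i \<noteq> inv' \<tau> i"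
    let ?c = "\<lambda>j \<in> {1..l}. x" and ?d = "\<lambda>j \<in> {1..l}. if j = inv' \<sigma> i then y else x"
    have "?c \<in> ?P" "?d \<in> ?P" using assms by auto
    from eq[OF i this(1)] eq[OF i this(2)] have "g (inv' \<sigma> i) x = g (inv' \<sigma> i) y"
      using in1[OF i] ne sym_group_in(2)[OF sym_group_in(1)[OF 1(4)] i] by simp
    then show False
      using g[OF in1[OF i]] assms by (auto simp: Bij_def bij_betw_def inj_on_def)
  qed
  have "inv' \<sigma> = inv' \<tau>"
  proof
    fix i
    show "inv' \<sigma> i = inv' \<tau> i"
      using inv sym_group_in(1)[OF 1(2)] sym_group_in(1)[OF 1(4)]
      by (cases "i \<in> {1..l}") (auto simp: sym_group_carrier permutes_not_in)
  qed
  then have st: "\<sigma> = \<tau>" using sym_group_in(5) 1(2,4) by metis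
  have "g j = h j" if j: "j \<in> {1..l}" for j
  proof (rule extensionalityI)
    show "g j \<in> extensional \<Gamma>" "h j \<in> extensional \<Gamma>"
      using g[OF j] h[OF j] by (auto simp: Bij_def)
    fix z assume "z \<in> \<Gamma>"
    then have "(\<lambda>j \<in> {1..l}. z) \<in> ?P" by auto
    from eq[OF sym_group_in(2)[OF 1(2) j] this] show "g j z = h j z"
      using j sym_group_in(4)[OF 1(2)] st by simp
  qed
  then have "g = h" by (rule PiE_ext[OF 1(1,3)])
  with st pq show "p = q" by simp
qed

end

theory Submission
  imports Defs "HOL-Computational_Algebra.Primes"
begin

text \<open>
  Suppose that \<open>G\<close> preserves an identification of \<open>\<Omega>\<close> with \<open>\<Gamma>\<^sup>l\<close>. Let \<open>M\<close> be its minimal normal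
  subgroup, which is transitive, and \<open>D\<close> the stabiliser of a point in \<open>M\<close>. A simple subdirect subgroup
  of a direct product of nonabelian simple groups is a full diagonal, so \<open>M\<close> is a power \<open>D\<^sup>k\<close> in
  which \<open>D\<close> consists of the constant families (\<open>simple_subdirect_imp_diagonal_power\<close>).

  The elements of \<open>M\<close> that fix each of the \<open>l\<close> coordinates form a normal subgroup of \<open>G\<close>, so it is
  trivial or \<open>M\<close>. If it is trivial, \<open>M\<close> embeds in the symmetric group of degree \<open>l\<close>; then \<open>|\<Gamma>|\<^sup>l\<close>
  divides \<open>l!\<close>, which is impossible (\<open>transitive_not_faithful_on_coords\<close>).

  Otherwise \<open>M\<close> acts on each coordinate. Let \<open>K i\<close> be the stabiliser in \<open>M\<close> of the \<open>i\<close>-th coordinate of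
  the base point. These subgroups contain \<open>D\<close>, and since \<open>M\<close> is transitive on \<open>\<Gamma>\<^sup>l\<close>, every \<open>K i\<close>
  together with the intersection of the others gives a factorisation of \<open>M\<close>. A subgroup of \<open>D\<^sup>k\<close> that
  contains the diagonal consists of the families that are constant on the blocks of a partition of
  \<open>{1, \<dots>, k}\<close>, and in terms of partitions the factorisations mean that the blocks form a hypergraph
  without cycles. So it has a leaf: some simple factor of \<open>M\<close> lies in all \<open>K i\<close> but at most one
  (\<open>factor_in_all_but_one\<close>). A leaf is found by descent (\<open>exists_leaf\<close>), which replaces the
  comparison of orders that is available for finite groups.

  Being normal in \<open>M\<close>, this factor acts on a single coordinate. As \<open>G\<close> permutes the coordinates, the
  product of the subgroups of \<open>M\<close> that act on a single coordinate is normal in \<open>G\<close>, and therefore it is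
  \<open>M\<close>. The subgroup \<open>D\<close> decomposes accordingly; as \<open>D\<close> is simple, it acts on one coordinate
  only, and the part of \<open>M\<close> that acts on another coordinate centralises \<open>D\<close>. But the
  centraliser of the diagonal in \<open>M\<close> is trivial, and \<open>M\<close> is transitive on the other coordinate, which
  takes at least two values (\<open>not_diagonal_power\<close>).
\<close>

section \<open>A power \<open>m\<^sup>n\<close> does not divide \<open>n!\<close>\<close>

text \<open>
  The multiples of \<open>p\<close> up to \<open>n\<close> are \<open>p \<cdot> 1, \<dots>, p \<cdot> (n div p)\<close>, and only they contribute to the
  power of \<open>p\<close> in \<open>n!\<close>. This is the recursive form of Legendre's formula.
\<close>

lemma multiplicity_fact_nat:
  fixes p n :: nat
  assumes p: "prime p"
  shows "multiplicity p (fact n :: nat) = n div p + multiplicity p (fact (n div p) :: nat)"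
proof (induction n)
  case 0
  show ?case by simp
next
  case (Suc n)
  have step: "multiplicity p (fact (Suc m) :: nat) = multiplicity p (Suc m) + multiplicity p (fact m :: nat)" for m
    unfolding fact_Suc using p
    by (simp add: prime_elem_multiplicity_mult_distrib del: mult_Suc)
  show ?case
  proof (cases "p dvd Suc n")
    case True
    then obtain q where q: "Suc n = p * q" by blast
    then obtain r where r: "q = Suc r" by (cases q) auto
    have div: "Suc n div p = Suc r" "n div p = r"
      proof -
      show "Suc n div p = Suc r" using q r prime_gt_0_nat[OF p] by simp
      then show "n div p = r" using True by (simp add: div_Suc mod_eq_0_iff_dvd)
    qed
    have "multiplicity p (Suc n) = Suc (multiplicity p (Suc r))"
      unfolding q r using prime_gt_1_nat[OF p] by (intro multiplicity_times_same) auto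
    then show ?thesis using Suc.IH div by (simp add: step del: fact_Suc)
  next
    case False
    then have "Suc n div p = n div p" by (simp add: div_Suc mod_eq_0_iff_dvd)
    then show ?thesis using Suc.IH False by (simp add: step not_dvd_imp_multiplicity_0 del: fact_Suc)
  qed
qed

lemma multiplicity_fact_less:
  fixes p n :: nat
  assumes p: "prime p" and "n \<ge> 1"
  shows "multiplicity p (fact n :: nat) < n"
  using \<open>n \<ge> 1\<close>
proof (induction n rule: less_induct)
  case (less n)
  have le: "2 * (n div p) \<le> n"
    using prime_ge_2_nat[OF p] by (metis div_mult_self_is_m dual_order.trans mult.commute mult_le_mono1 times_div_less_eq_dividend)
  show ?case
  proof (cases "n div p = 0")
    case True
    then show ?thesis using less.prems multiplicity_fact_nat[OF p, of n] by simp
  next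
    case False
    then have "multiplicity p (fact (n div p) :: nat) < n div p"
      using less.IH[of "n div p"] le less.prems by linarith
    then show ?thesis using multiplicity_fact_nat[OF p, of n] le by linarith
  qed
qed

lemma power_not_dvd_fact:
  fixes m n :: nat
  assumes "m \<ge> 2" and "n \<ge> 1"
  shows "\<not> m ^ n dvd fact n"
proof
  assume dvd: "m ^ n dvd (fact n :: nat)"
  obtain p where p: "prime p" "p dvd m" using prime_factor_nat[of m] assms by auto
  then have "p ^ n dvd (fact n :: nat)" using dvd dvd_power_same dvd_trans by blast
  then have "n \<le> multiplicity p (fact n :: nat)"
    using p by (intro multiplicity_geI) auto
  then show False using multiplicity_fact_less[OF p(1) assms(2)] by simp
qed

section \<open>Leaves of a forest of relations\<close>

text \<open>
  For an equivalence relation \<open>R i\<close>, the saturated subsets of \<open>J\<close> are the unions of classes.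
\<close>

definition saturated :: "('i \<Rightarrow> 'j \<Rightarrow> 'j \<Rightarrow> bool) \<Rightarrow> 'j set \<Rightarrow> 'i \<Rightarrow> 'j set \<Rightarrow> bool"
  where "saturated R J i A \<longleftrightarrow> (\<forall>a \<in> A. \<forall>b \<in> J. R i a b \<longrightarrow> b \<in> A)"

text \<open>
  Read \<open>R i a b\<close> as a link between \<open>a\<close> and \<open>b\<close> of kind \<open>i\<close>. The assumption \<open>cut\<close> says that the vertices
  linked to \<open>e\<close> by kind \<open>i\<close> lie in a set \<open>B\<close> that no link leaves, except those of kind \<open>i\<close> to \<open>e\<close>. This
  excludes cycles that use several kinds of links, and the conclusion is the existence of a leaf: a
  vertex that is linked to other vertices by at most one kind.

  Leaves are found by walking away from the start. Let \<open>B\<close> be a set as above for \<open>i\<close> and \<open>e\<close>,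
  and let \<open>a \<noteq> e\<close> be linked to \<open>e\<close> by kind \<open>i\<close>. If \<open>a\<close> is also linked to some vertex by another kind
  \<open>i'\<close>, let \<open>B'\<close> be such a set for \<open>i'\<close> and \<open>a\<close>. Then \<open>B \<inter> B'\<close> is one as well, and it is smaller than
  \<open>B\<close> because it omits \<open>a\<close>.
\<close>

lemma exists_leaf:
  assumes fin: "finite J" and ne: "J \<noteq> {}"
    and sym: "\<And>i a b. R i a b \<Longrightarrow> R i b a"
    and cut: "\<And>i e. i \<in> I \<Longrightarrow> e \<in> J \<Longrightarrow> \<exists>B \<subseteq> J. e \<notin> B \<and> saturated R J i (insert e B) \<and>
      (\<forall>i' \<in> I - {i}. saturated R J i' B)"
  obtains e where "e \<in> J"
    "\<And>i i' a b. i \<in> I \<Longrightarrow> i' \<in> I \<Longrightarrow> i \<noteq> i' \<Longrightarrow> a \<in> J - {e} \<Longrightarrow> b \<in> J - {e} \<Longrightarrow>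
       R i e a \<Longrightarrow> \<not> R i' e b"
proof -
  let ?link = "\<lambda>i e. \<exists>a \<in> J - {e}. R i e a"
  have claim: "\<exists>e \<in> J. \<forall>i \<in> I. \<forall>i' \<in> I. ?link i e \<and> ?link i' e \<longrightarrow> i = i'"
    if "i \<in> I" "e \<in> J" "?link i e" "B \<subseteq> J" "e \<notin> B" "saturated R J i (insert e B)"
      "\<forall>i' \<in> I - {i}. saturated R J i' B" for i e B
    using that
  proof (induction "card B" arbitrary: i e B rule: less_induct)
    case less
    obtain a where a: "a \<in> J" "a \<noteq> e" "R i e a" using less.prems(3) by blast
    have aB: "a \<in> B" using a less.prems(6) unfolding saturated_def by blast
    show ?case
    proof (cases "\<exists>i' \<in> I - {i}. ?link i' a")
      case False
      then have "\<forall>i1 \<in> I. \<forall>i2 \<in> I. ?link i1 a \<and> ?link i2 a \<longrightarrow> i1 = i2" by blast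
      then show ?thesis using a(1) by blast
    next
      case True
      then obtain i' where i': "i' \<in> I" "i' \<noteq> i" "?link i' a" by blast
      obtain B' where B': "B' \<subseteq> J" "a \<notin> B'" "saturated R J i' (insert a B')"
        "\<forall>i'' \<in> I - {i'}. saturated R J i'' B'"
        using cut[OF i'(1) a(1)] by blast
      \<comment> \<open>\<open>B'\<close> is saturated for \<open>R i\<close> and omits \<open>a\<close>, which \<open>R i\<close> links to \<open>e\<close>.\<close>
      have "e \<notin> B'"
        using B'(2,4) a less.prems(1) i'(2) unfolding saturated_def by blast
      have 1: "saturated R J i' (insert a (B \<inter> B'))"
        using B'(3) less.prems(7) i' aB unfolding saturated_def by blast
      have 2: "saturated R J i'' (B \<inter> B')" if "i'' \<in> I - {i'}" for i''
      proof (cases "i'' = i")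
        case True
        then show ?thesis using less.prems(6) B'(4) that \<open>e \<notin> B'\<close> unfolding saturated_def by blast
      next
        case False
        then show ?thesis using less.prems(7) B'(4) that unfolding saturated_def by blast
      qed
      have "card (B \<inter> B') < card B"
        using aB B'(2) finite_subset[OF less.prems(4) fin] by (intro psubset_card_mono) auto
      then show ?thesis
        using less.hyps[of "B \<inter> B'" i' a] i' a(1) B'(2) less.prems(4) 1 2 by blast
    qed
  qed
  have "\<exists>e \<in> J. \<forall>i \<in> I. \<forall>i' \<in> I. ?link i e \<and> ?link i' e \<longrightarrow> i = i'"
  proof (cases "\<exists>i \<in> I. \<exists>e \<in> J. ?link i e")
    case True
    then obtain i e where ie: "i \<in> I" "e \<in> J" "?link i e" by blast
    then show ?thesis using cut[OF ie(1,2)] claim[OF ie] by blast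
  next
    case False
    then show ?thesis using ne by blast
  qed
  then show thesis using that by blast
qed

section \<open>Powers of a simple group with a full diagonal subgroup\<close>

text \<open>
  The maps \<open>\<delta> j\<close> are the coordinates of an isomorphism of \<open>M\<close> with the power \<open>D\<^sup>J\<close>. Each of them is a
  retraction onto the subgroup \<open>D\<close>, so that \<open>D\<close> is the set of constant families. Using \<open>D\<close> itself as
  the group of coordinate values makes the entries of an element at different indices comparable.
\<close>

locale diagonal_power = group M for M (structure) +
  fixes D :: "'a set" and J :: "'j set" and \<delta> :: "'j \<Rightarrow> 'a \<Rightarrow> 'a"
  assumes finite_index: "finite J"
    and subgroup_diagonal: "subgroup D M"
    and simple_diagonal: "is_simple (M\<lparr>carrier := D\<rparr>)"
    and nonabelian_diagonal: "\<exists>a \<in> D. \<exists>b \<in> D. a \<otimes> b \<noteq> b \<otimes> a"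
    and coord_hom: "j \<in> J \<Longrightarrow> \<delta> j \<in> hom M (M\<lparr>carrier := D\<rparr>)"
    and coord_diagonal: "j \<in> J \<Longrightarrow> d \<in> D \<Longrightarrow> \<delta> j d = d"
    and coords_inj: "x \<in> carrier M \<Longrightarrow> y \<in> carrier M \<Longrightarrow> (\<And>j. j \<in> J \<Longrightarrow> \<delta> j x = \<delta> j y) \<Longrightarrow> x = y"
    and coords_surj: "f \<in> J \<rightarrow> D \<Longrightarrow> \<exists>x \<in> carrier M. \<forall>j \<in> J. \<delta> j x = f j"
begin

definition factor :: "'j \<Rightarrow> 'a set"
  where "factor j = {x \<in> carrier M. \<forall>j' \<in> J - {j}. \<delta> j' x = \<one>}"

lemma diagonal_carrier: "d \<in> D \<Longrightarrow> d \<in> carrier M"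
  using subgroup.mem_carrier[OF subgroup_diagonal] .

lemma coord_closed: "j \<in> J \<Longrightarrow> x \<in> carrier M \<Longrightarrow> \<delta> j x \<in> D"
  using coord_hom by (auto simp: hom_def)

lemma coord_mult:
  "j \<in> J \<Longrightarrow> x \<in> carrier M \<Longrightarrow> y \<in> carrier M \<Longrightarrow> \<delta> j (x \<otimes> y) = \<delta> j x \<otimes> \<delta> j y"
  using coord_hom by (auto simp: hom_def)

lemma coord_one: "j \<in> J \<Longrightarrow> \<delta> j \<one> = \<one>"
  using coord_diagonal subgroup.one_closed[OF subgroup_diagonal] by blast

lemma coord_inv: "j \<in> J \<Longrightarrow> x \<in> carrier M \<Longrightarrow> \<delta> j (inv x) = inv (\<delta> j x)"
  using coord_mult[of j "inv x" x] coord_one[of j] diagonal_carrier coord_closed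
  by (metis inv_closed inv_equality l_inv)

lemma normal_in_diagonal_trivial_or_all:
  assumes N: "subgroup N M" "N \<subseteq> D" and conj: "\<And>d x. d \<in> D \<Longrightarrow> x \<in> N \<Longrightarrow> d \<otimes> x \<otimes> inv d \<in> N"
    and "N \<noteq> {\<one>}"
  shows "N = D"
proof -
  interpret D: group "M\<lparr>carrier := D\<rparr>" using subgroup_imp_group[OF subgroup_diagonal] .
  have "N \<lhd> M\<lparr>carrier := D\<rparr>"
    unfolding D.normal_inv_iff
    using subgroup_incl[OF N(1) subgroup_diagonal N(2)] conj m_inv_consistent[OF subgroup_diagonal]
    by simp
  then show ?thesis using simple_diagonal assms(4) unfolding is_simple_def by auto
qed

lemma diagonal_centre_trivial:
  assumes "z \<in> D" and "\<And>d. d \<in> D \<Longrightarrow> z \<otimes> d = d \<otimes> z"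
  shows "z = \<one>"
proof (rule ccontr)
  assume "z \<noteq> \<one>"
  define C where "C = {z \<in> D. \<forall>d \<in> D. z \<otimes> d = d \<otimes> z}"
  have CD: "x \<in> D" "x \<in> carrier M" and comm: "d \<in> D \<Longrightarrow> x \<otimes> d = d \<otimes> x" if "x \<in> C" for x d
    using that diagonal_carrier by (auto simp: C_def)
  have CI: "x \<in> C" if "x \<in> D" "\<And>d. d \<in> D \<Longrightarrow> x \<otimes> d = d \<otimes> x" for x
    using that by (simp add: C_def)
  have "subgroup C M"
  proof (rule subgroupI)
    show "C \<subseteq> carrier M" using CD by blast
    show "C \<noteq> {}" using CI assms by blast
  next
    fix x assume x: "x \<in> C"
    show "inv x \<in> C"
    proof (rule CI)
      show "inv x \<in> D" using CD[OF x] subgroup.m_inv_closed[OF subgroup_diagonal] by blast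
      fix d assume d: "d \<in> D"
      show "inv x \<otimes> d = d \<otimes> inv x"
        using comm[OF x d] CD[OF x] diagonal_carrier[OF d]
        by (metis inv_closed inv_solve_left inv_solve_right m_assoc m_closed)
    qed
  next
    fix x y assume x: "x \<in> C" and y: "y \<in> C"
    show "x \<otimes> y \<in> C"
    proof (rule CI)
      show "x \<otimes> y \<in> D" using CD[OF x] CD[OF y] subgroup.m_closed[OF subgroup_diagonal] by blast
      fix d assume d: "d \<in> D"
      show "x \<otimes> y \<otimes> d = d \<otimes> (x \<otimes> y)"
        using comm[OF x d] comm[OF y d] CD[OF x] CD[OF y] diagonal_carrier[OF d]
        by (metis m_assoc)
    qed
  qed
  moreover have "d \<otimes> x \<otimes> inv d \<in> C" if d: "d \<in> D" and x: "x \<in> C" for d x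
  proof -
    have "d \<otimes> x \<otimes> inv d = x"
      using comm[OF x d] CD[OF x] diagonal_carrier[OF d] by (metis inv_solve_right' m_closed)
    then show ?thesis using x by simp
  qed
  moreover have "C \<noteq> {\<one>}" using CI[OF assms] \<open>z \<noteq> \<one>\<close> by blast
  ultimately have "C = D" using CD by (intro normal_in_diagonal_trivial_or_all) auto
  then show False using nonabelian_diagonal comm by blast
qed

lemma centralizer_diagonal_trivial:
  assumes y: "y \<in> carrier M" and "\<And>d. d \<in> D \<Longrightarrow> y \<otimes> d = d \<otimes> y"
  shows "y = \<one>"
proof (rule coords_inj[OF y one_closed])
  fix j assume j: "j \<in> J"
  have "\<delta> j y \<otimes> d = d \<otimes> \<delta> j y" if "d \<in> D" for d
    using coord_mult[OF j y] coord_mult[OF j _ y] assms(2)[OF that] coord_diagonal[OF j that]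
      diagonal_carrier[OF that] by metis
  then show "\<delta> j y = \<delta> j \<one>"
    using diagonal_centre_trivial coord_closed[OF j y] coord_one[OF j] by metis
qed

lemma diagonal_nontrivial: obtains d where "d \<in> D" "d \<noteq> \<one>"
  using nonabelian_diagonal diagonal_carrier by (metis l_one r_one)

lemma factor_element:
  assumes "d \<in> D" "j \<in> J"
  obtains x where "x \<in> factor j" "\<delta> j x = d"
proof -
  have "(\<lambda>i. if i = j then d else \<one>) \<in> J \<rightarrow> D"
    using assms subgroup.one_closed[OF subgroup_diagonal] by auto
  from coords_surj[OF this] obtain x where "x \<in> carrier M"
    "\<forall>i \<in> J. \<delta> i x = (if i = j then d else \<one>)" by blast
  then show thesis using that[of x] assms by (auto simp: factor_def)
qed

lemma factor_nontrivial: "j \<in> J \<Longrightarrow> \<exists>x \<in> factor j. x \<noteq> \<one>"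
  by (metis diagonal_nontrivial factor_element coord_one)

lemma factor_conj:
  assumes "x \<in> factor j" "y \<in> carrier M"
  shows "y \<otimes> x \<otimes> inv y \<in> factor j"
  using assms by (auto simp: factor_def coord_mult coord_inv coord_closed diagonal_carrier)

text \<open>
  This is the argument behind the classification of subdirect subgroups of powers of a nonabelian
  simple group. For \<open>A \<subseteq> J - {j}\<close> consider the entries at \<open>j\<close> of the elements of \<open>K\<close> whose
  entries on \<open>A\<close> are trivial. They form a normal subgroup of \<open>D\<close> as \<open>D \<subseteq> K\<close>, hence \<open>{\<one>}\<close> or \<open>D\<close>. Enlarging \<open>A\<close>
  by one index keeps it equal to \<open>D\<close>: the commutator of an element that is trivial at the new index
  with an element that is trivial on \<open>A\<close> is trivial at all these indices, and both can be chosen such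
  that their entries at \<open>j\<close> do not commute. For \<open>A = J - {j}\<close> the claim is the lemma.
\<close>

lemma separated_factor_subset:
  assumes K: "subgroup K M" "D \<subseteq> K" and j: "j \<in> J"
    and sep: "\<And>j'. j' \<in> J - {j} \<Longrightarrow> \<exists>x \<in> K. \<delta> j x \<noteq> \<delta> j' x"
  shows "factor j \<subseteq> K"
proof -
  note Kc [simp] = subgroup.mem_carrier[OF K(1)] subgroup.m_closed[OF K(1)]
    subgroup.m_inv_closed[OF K(1)] subgroup.one_closed[OF K(1)]
  note [simp] = diagonal_carrier coord_closed coord_mult coord_inv coord_one
  define V where "V A = {x \<in> K. \<forall>a \<in> A. \<delta> a x = \<one>}" for A
  have "finite A \<Longrightarrow> A \<subseteq> J - {j} \<Longrightarrow> \<delta> j ` V A = D" for A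
  proof (induction A rule: finite_induct)
    case empty
    show ?case
    proof
      show "\<delta> j ` V {} \<subseteq> D" using j by (auto simp: V_def)
      show "D \<subseteq> \<delta> j ` V {}" using K(2) coord_diagonal[OF j] by (auto simp: V_def image_iff) force
    qed
  next
    case (insert a A)
    have aJ: "a \<in> J" "a \<noteq> j" and AJ: "\<And>i. i \<in> A \<Longrightarrow> i \<in> J" using insert.prems by auto
    obtain x where x: "x \<in> K" "\<delta> j x \<noteq> \<delta> a x" using sep[of a] insert.prems by blast
    have dK: "\<delta> a x \<in> K" "\<delta> a x \<in> D" using x aJ K(2) by auto
    \<comment> \<open>Dividing \<open>x\<close> by the diagonal element with the same entry at \<open>a\<close> makes that entry trivial.\<close>
    define u where "u = x \<otimes> inv (\<delta> a x)"
    have u: "u \<in> K" "\<delta> a u = \<one>" "\<delta> j u = \<delta> j x \<otimes> inv (\<delta> a x)"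
      unfolding u_def using x dK aJ j by (simp_all add: coord_diagonal)
    have ujne: "\<delta> j u \<noteq> \<one>" using x(2) u(3) x dK j by (metis Kc(1) coord_closed diagonal_carrier inv_closed inv_equality inv_inv)
    have ujD: "\<delta> j u \<in> D" using u(1) j by simp
    obtain w where w: "w \<in> D" "\<delta> j u \<otimes> w \<noteq> w \<otimes> \<delta> j u"
      using diagonal_centre_trivial[OF ujD] ujne by blast
    obtain y where y: "y \<in> V A" "\<delta> j y = w" using insert.IH insert.prems w(1) by (metis (no_types, lifting) image_iff insert_subset)
    then have yK: "y \<in> K" and yA: "\<And>i. i \<in> A \<Longrightarrow> \<delta> i y = \<one>" by (auto simp: V_def)
    let ?c = "u \<otimes> y \<otimes> inv u \<otimes> inv y"
    have cV: "?c \<in> V (insert a A)"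
      using u yK yA AJ aJ by (auto simp: V_def)
    have "\<delta> j ?c \<noteq> \<one>"
    proof
      assume "\<delta> j ?c = \<one>"
      then have "\<delta> j u \<otimes> w \<otimes> inv (\<delta> j u) \<otimes> inv w = \<one>" using u yK y(2) j by simp
      then have "\<delta> j u \<otimes> w = w \<otimes> \<delta> j u"
        using w(1) ujD by (metis diagonal_carrier inv_closed inv_equality inv_inv inv_solve_right m_closed)
      then show False using w by simp
    qed
    then have ne: "\<delta> j ` V (insert a A) \<noteq> {\<one>}" using cV by blast
    have IJ: "\<And>i. i \<in> insert a A \<Longrightarrow> i \<in> J" using aJ AJ by blast
    have sub: "subgroup (\<delta> j ` V (insert a A)) M"
    proof (rule subgroupI)
      show "\<delta> j ` V (insert a A) \<subseteq> carrier M" using j by (auto simp: V_def)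
      show "\<delta> j ` V (insert a A) \<noteq> {}" using cV by blast
    next
      fix v assume "v \<in> \<delta> j ` V (insert a A)"
      then obtain z where z: "z \<in> V (insert a A)" "v = \<delta> j z" by blast
      have "inv z \<in> V (insert a A)" using z(1) IJ by (auto simp: V_def)
      moreover have "inv v = \<delta> j (inv z)" using z j by (auto simp: V_def)
      ultimately show "inv v \<in> \<delta> j ` V (insert a A)" by blast
    next
      fix v v' assume "v \<in> \<delta> j ` V (insert a A)" "v' \<in> \<delta> j ` V (insert a A)"
      then obtain z z' where z: "z \<in> V (insert a A)" "v = \<delta> j z" "z' \<in> V (insert a A)" "v' = \<delta> j z'" by blast
      have "z \<otimes> z' \<in> V (insert a A)" using z(1,3) IJ by (auto simp: V_def)
      moreover have "v \<otimes> v' = \<delta> j (z \<otimes> z')" using z j by (auto simp: V_def)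
      ultimately show "v \<otimes> v' \<in> \<delta> j ` V (insert a A)" by blast
    qed
    show ?case
    proof (rule normal_in_diagonal_trivial_or_all[OF sub _ _ ne])
      show "\<delta> j ` V (insert a A) \<subseteq> D" using j by (auto simp: V_def)
    next
      fix d v assume d: "d \<in> D" and "v \<in> \<delta> j ` V (insert a A)"
      then obtain z where z: "z \<in> V (insert a A)" "v = \<delta> j z" by blast
      have dK: "d \<in> K" using d K(2) by blast
      have "d \<otimes> z \<otimes> inv d \<in> V (insert a A)" using z(1) IJ d dK by (auto simp: V_def coord_diagonal)
      moreover have "d \<otimes> v \<otimes> inv d = \<delta> j (d \<otimes> z \<otimes> inv d)" using z j d by (auto simp: V_def coord_diagonal)
      ultimately show "d \<otimes> v \<otimes> inv d \<in> \<delta> j ` V (insert a A)" by blast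
    qed
  qed
  then have all: "\<delta> j ` V (J - {j}) = D" using finite_index by simp
  show ?thesis
  proof
    fix x assume x: "x \<in> factor j"
    then have xM: "x \<in> carrier M" by (simp add: factor_def)
    then obtain y where y: "y \<in> V (J - {j})" "\<delta> j x = \<delta> j y"
      using all coord_closed[OF j] by (metis image_iff)
    have "x = y"
    proof (rule coords_inj[OF xM])
      show "y \<in> carrier M" using y by (auto simp: V_def)
      show "\<delta> i x = \<delta> i y" if "i \<in> J" for i
        using that x y by (cases "i = j") (auto simp: factor_def V_def)
    qed
    then show "x \<in> K" using y by (auto simp: V_def)
  qed
qed

text \<open>
  Call two indices linked by kind \<open>i\<close> if all elements of \<open>K i\<close> have equal entries there. By
  \<open>separated_factor_subset\<close>, \<open>factor j\<close> is contained in \<open>K i\<close> unless \<open>j\<close> is linked to another index by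
  kind \<open>i\<close>, so a leaf of this system of links is wanted. The factorisations of \<open>M\<close> provide the cuts:
  write as \<open>p \<otimes> q\<close> an element whose only nontrivial entry is \<open>t\<close> at \<open>e\<close>. Let \<open>B\<close> be the set where the
  entry of \<open>q\<close> is inverse to the entry of \<open>p\<close> at \<open>e\<close>. No link of a kind other than \<open>i\<close> leaves \<open>B\<close>, as
  \<open>q\<close> lies in the other \<open>K i'\<close>. Away from \<open>e\<close> the entries of \<open>p\<close> and \<open>q\<close> are inverse to each other, so
  \<open>B \<union> {e}\<close> is the set where \<open>p\<close> has the same entry as at \<open>e\<close>, and no link of kind \<open>i\<close> leaves it.
\<close>

lemma factor_in_all_but_one:
  assumes ne: "J \<noteq> {}"
    and K: "\<And>i. i \<in> I \<Longrightarrow> subgroup (K i) M" "\<And>i. i \<in> I \<Longrightarrow> D \<subseteq> K i"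
    and fac: "\<And>i x. i \<in> I \<Longrightarrow> x \<in> carrier M \<Longrightarrow> \<exists>p \<in> K i. \<exists>q \<in> carrier M. x = p \<otimes> q \<and> (\<forall>i' \<in> I - {i}. q \<in> K i')"
  obtains j where "j \<in> J"
    "\<And>i i'. i \<in> I \<Longrightarrow> i' \<in> I \<Longrightarrow> i \<noteq> i' \<Longrightarrow> factor j \<subseteq> K i \<or> factor j \<subseteq> K i'"
proof -
  define R where "R i a b \<longleftrightarrow> (\<forall>x \<in> K i. \<delta> a x = \<delta> b x)" for i a b
  have cut: "\<exists>B \<subseteq> J. e \<notin> B \<and> saturated R J i (insert e B) \<and> (\<forall>i' \<in> I - {i}. saturated R J i' B)"
    if i: "i \<in> I" and e: "e \<in> J" for i e
  proof -
    obtain t where t: "t \<in> D" "t \<noteq> \<one>" by (rule diagonal_nontrivial)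
    obtain x where x: "x \<in> factor e" "\<delta> e x = t" by (rule factor_element[OF t(1) e])
    have xM: "x \<in> carrier M" using x by (simp add: factor_def)
    obtain p q where pq: "p \<in> K i" "q \<in> carrier M" "x = p \<otimes> q" "\<forall>i' \<in> I - {i}. q \<in> K i'"
      using fac[OF i xM] by blast
    have pM: "p \<in> carrier M" using subgroup.mem_carrier[OF K(1)[OF i] pq(1)] .
    let ?B = "{f \<in> J. \<delta> f q = inv (\<delta> e p)}"
    have qp: "\<delta> f q = inv (\<delta> f p) \<otimes> \<delta> f x" if "f \<in> J" for f
      using coord_mult[OF that pM pq(2)] inv_solve_left[of "\<delta> f q" "\<delta> f p" "\<delta> f x"] pq(2,3) pM xM
        coord_closed[OF that] diagonal_carrier by simp
    have ep: "\<delta> e p \<in> carrier M" using e pM coord_closed diagonal_carrier by blast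
    have "\<delta> e q \<noteq> inv (\<delta> e p)"
    proof
      assume "\<delta> e q = inv (\<delta> e p)"
      then have "inv (\<delta> e p) \<otimes> t = inv (\<delta> e p)" using qp[OF e] x by simp
      then show False using t(2) l_cancel_one[OF inv_closed[OF ep] diagonal_carrier[OF t(1)]] by simp
    qed
    then have enB: "e \<notin> ?B" by simp
    have B: "insert e ?B = {f \<in> J. \<delta> f p = \<delta> e p}"
    proof -
      have "\<delta> f q = inv (\<delta> e p) \<longleftrightarrow> \<delta> f p = \<delta> e p" if f: "f \<in> J" "f \<noteq> e" for f
      proof -
        have "\<delta> f x = \<one>" using x f by (auto simp: factor_def)
        then have "\<delta> f q = inv (\<delta> f p)" using qp[OF f(1)] f(1) pM coord_closed diagonal_carrier by simp
        then show ?thesis using inj_onD[OF inv_inj _ diagonal_carrier[OF coord_closed[OF f(1) pM]] ep] by auto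
      qed
      then show ?thesis using e by auto
    qed
    have "saturated R J i (insert e ?B)"
    proof -
      have "\<delta> b p = \<delta> a p" if "R i a b" for a b using that pq(1) by (simp add: R_def)
      then show ?thesis using B by (auto simp: saturated_def)
    qed
    moreover have "saturated R J i' ?B" if "i' \<in> I - {i}" for i'
    proof -
      have "q \<in> K i'" using pq(4) that by blast
      then have "\<delta> b q = \<delta> a q" if "R i' a b" for a b using that by (simp add: R_def)
      then show ?thesis by (auto simp: saturated_def)
    qed
    ultimately show ?thesis using enB by (intro exI[of _ ?B]) blast
  qed
  obtain j where j: "j \<in> J"
    "\<And>i i' a b. i \<in> I \<Longrightarrow> i' \<in> I \<Longrightarrow> i \<noteq> i' \<Longrightarrow> a \<in> J - {j} \<Longrightarrow> b \<in> J - {j} \<Longrightarrow>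
       R i j a \<Longrightarrow> \<not> R i' j b"
    by (rule exists_leaf[of J R I, OF finite_index ne _ cut]) (auto simp: R_def)
  show thesis
  proof (rule that[OF j(1)])
    fix i i' assume ii: "i \<in> I" "i' \<in> I" "i \<noteq> i'"
    then consider "\<forall>a \<in> J - {j}. \<not> R i j a" | "\<forall>a \<in> J - {j}. \<not> R i' j a"
      using j(2)[OF ii] by blast
    then show "factor j \<subseteq> K i \<or> factor j \<subseteq> K i'"
    proof cases
      case 1
      then have "factor j \<subseteq> K i"
        by (intro separated_factor_subset K ii j(1)) (auto simp: R_def)
      then show ?thesis ..
    next
      case 2
      then have "factor j \<subseteq> K i'"
        by (intro separated_factor_subset K ii j(1)) (auto simp: R_def)
      then show ?thesis ..
    qed
  qed
qed

end

text \<open>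
  A projection of the simple group \<open>D\<close> onto a nontrivial group is injective, hence a subdirect
  simple \<open>D\<close> is a full diagonal. The retraction \<open>\<delta> i\<close> is the projection of \<open>M\<close> to \<open>T i\<close> followed by
  the inverse of the projection of \<open>D\<close> to \<open>T i\<close>.
\<close>

lemma simple_subdirect_imp_diagonal_power:
  assumes M: "group M" and D: "subgroup D M" "is_simple (M\<lparr>carrier := D\<rparr>)"
    and J: "finite J" "J \<noteq> {}"
    and T: "\<And>i. i \<in> J \<Longrightarrow> is_simple (T i)" "\<And>i. i \<in> J \<Longrightarrow> \<not> comm_group (T i)"
    and h: "h \<in> iso M (product_group J T)" and sub: "subdirect J T (h ` D)"
  shows "diagonal_power M D J (\<lambda>i x. inv_into D (\<lambda>d. h d i) (h x i))"
proof -
  interpret M: group M by (rule M)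
  let ?D = "M\<lparr>carrier := D\<rparr>"
  interpret D: group ?D using M.subgroup_imp_group[OF D(1)] .
  have Dc: "d \<in> carrier M" if "d \<in> D" for d using that subgroup.mem_carrier[OF D(1)] by blast
  have Tg: "group (T i)" if "i \<in> J" for i using T(1)[OF that] by (simp add: is_simple_def)
  have hc: "h x i \<in> carrier (T i)" if "x \<in> carrier M" "i \<in> J" for x i
    using h that by (auto simp: iso_def hom_def)
  have hm: "h (x \<otimes>\<^bsub>M\<^esub> y) i = h x i \<otimes>\<^bsub>T i\<^esub> h y i" if "x \<in> carrier M" "y \<in> carrier M" "i \<in> J" for x y i
    using h that by (simp add: iso_def hom_def)
  have h_ext: "h x \<in> extensional J" if "x \<in> carrier M" for x
    using h that by (auto simp: iso_def hom_def PiE_def)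
  have onto: "(\<lambda>d. h d i) ` D = carrier (T i)" if "i \<in> J" for i
    using sub that by (simp add: subdirect_def image_image)
  have inj: "inj_on (\<lambda>d. h d i) D" if i: "i \<in> J" for i
  proof -
    have hom: "group_hom ?D (T i) (\<lambda>d. h d i)"
      using Tg[OF i] hc[OF Dc i] hm[OF Dc Dc i] D.is_group
      by (auto simp: group_hom_def group_hom_axioms_def hom_def)
    have "kernel ?D (T i) (\<lambda>d. h d i) \<noteq> D"
    proof
      assume "kernel ?D (T i) (\<lambda>d. h d i) = D"
      then have "carrier (T i) \<subseteq> {\<one>\<^bsub>T i\<^esub>}" unfolding onto[OF i, symmetric] by (auto simp: kernel_def)
      then have "carrier (T i) = {\<one>\<^bsub>T i\<^esub>}"
        using monoid.one_closed[OF group.is_monoid[OF Tg[OF i]]] by blast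
      then show False using T(1)[OF i] by (simp add: is_simple_def)
    qed
    then have "kernel ?D (T i) (\<lambda>d. h d i) = {\<one>\<^bsub>?D\<^esub>}"
      using D(2) group_hom.normal_kernel[OF hom] by (auto simp: is_simple_def)
    then show ?thesis using group_hom.trivial_ker_imp_inj[OF hom] by simp
  qed
  let ?\<delta> = "\<lambda>i x. inv_into D (\<lambda>d. h d i) (h x i)"
  have dc: "?\<delta> i x \<in> D" and hd: "h (?\<delta> i x) i = h x i" if "i \<in> J" "x \<in> carrier M" for i x
  proof -
    have "h x i \<in> (\<lambda>d. h d i) ` D" using onto[OF that(1)] hc[OF that(2,1)] by simp
    from inv_into_into[OF this] f_inv_into_f[OF this] show "?\<delta> i x \<in> D" "h (?\<delta> i x) i = h x i" .
  qed
  show ?thesis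
  proof (intro diagonal_power.intro diagonal_power_axioms.intro)
    show "group M" "finite J" "subgroup D M" "is_simple ?D" by fact+
  next
    obtain i where i: "i \<in> J" using J(2) by blast
    show "\<exists>a\<in>D. \<exists>b\<in>D. a \<otimes>\<^bsub>M\<^esub> b \<noteq> b \<otimes>\<^bsub>M\<^esub> a"
    proof (rule ccontr)
      assume "\<not> ?thesis"
      then have comm: "a \<otimes>\<^bsub>M\<^esub> b = b \<otimes>\<^bsub>M\<^esub> a" if "a \<in> D" "b \<in> D" for a b using that by blast
      have "x \<otimes>\<^bsub>T i\<^esub> y = y \<otimes>\<^bsub>T i\<^esub> x" if "x \<in> carrier (T i)" "y \<in> carrier (T i)" for x y
      proof -
        obtain a b where "a \<in> D" "b \<in> D" "x = h a i" "y = h b i"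
          using \<open>x \<in> carrier (T i)\<close> \<open>y \<in> carrier (T i)\<close> unfolding onto[OF i, symmetric] by blast
        then show ?thesis using comm hm[OF Dc Dc i] by metis
      qed
      then have "comm_group (T i)" by (intro group.group_comm_groupI[OF Tg[OF i]])
      then show False using T(2)[OF i] by simp
    qed
  next
    fix i assume i: "i \<in> J"
    show "?\<delta> i \<in> hom M ?D"
    proof (rule homI)
      show "?\<delta> i x \<in> carrier ?D" if "x \<in> carrier M" for x using dc[OF i that] by simp
      fix x y assume xy: "x \<in> carrier M" "y \<in> carrier M"
      have mD: "?\<delta> i x \<otimes>\<^bsub>M\<^esub> ?\<delta> i y \<in> D"
        using subgroup.m_closed[OF D(1)] dc[OF i] xy by blast
      have "?\<delta> i (x \<otimes>\<^bsub>M\<^esub> y) = ?\<delta> i x \<otimes>\<^bsub>M\<^esub> ?\<delta> i y"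
      proof (rule inj_onD[OF inj[OF i] _ dc[OF i] mD])
        show "h (?\<delta> i (x \<otimes>\<^bsub>M\<^esub> y)) i = h (?\<delta> i x \<otimes>\<^bsub>M\<^esub> ?\<delta> i y) i"
          unfolding hm[OF Dc[OF dc[OF i xy(1)]] Dc[OF dc[OF i xy(2)]] i] hd[OF i xy(1)] hd[OF i xy(2)]
            hd[OF i M.m_closed[OF xy]] by (rule hm[OF xy i])
      qed (use xy in simp)
      then show "?\<delta> i (x \<otimes>\<^bsub>M\<^esub> y) = ?\<delta> i x \<otimes>\<^bsub>?D\<^esub> ?\<delta> i y" by simp
    qed
    show "?\<delta> i d = d" if "d \<in> D" for d using inv_into_f_f[OF inj[OF i] that] .
  next
    fix x y assume xy: "x \<in> carrier M" "y \<in> carrier M" and eq: "\<And>i. i \<in> J \<Longrightarrow> ?\<delta> i x = ?\<delta> i y"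
    have "h x = h y"
    proof (rule extensionalityI[OF h_ext[OF xy(1)] h_ext[OF xy(2)]])
      show "h x i = h y i" if "i \<in> J" for i
        by (rule trans[OF hd[OF that xy(1), unfolded eq[OF that], symmetric] hd[OF that xy(2)]])
    qed
    moreover have "inj_on h (carrier M)" using h by (simp add: iso_def bij_betw_def)
    ultimately show "x = y" using xy by (simp add: inj_on_eq_iff)
  next
    fix f assume f: "f \<in> J \<rightarrow> D"
    then have "(\<lambda>i\<in>J. h (f i) i) \<in> carrier (product_group J T)" using hc Dc by auto
    moreover have "h ` carrier M = carrier (product_group J T)"
      using h unfolding iso_def bij_betw_def by blast
    ultimately obtain x where x: "x \<in> carrier M" "h x = (\<lambda>i\<in>J. h (f i) i)"
      by (metis (no_types, lifting) imageE)
    have "?\<delta> i x = f i" if "i \<in> J" for i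
      using inv_into_f_f[OF inj[OF that], of "f i"] x(2) that f by auto
    then show "\<exists>x\<in>carrier M. \<forall>i\<in>J. ?\<delta> i x = f i" using x(1) by blast
  qed
qed

section \<open>Permutations\<close>

lemma BijGroup_maps_to: "g \<in> carrier (BijGroup S) \<Longrightarrow> x \<in> S \<Longrightarrow> g x \<in> S"
  by (simp add: BijGroup_def Bij_in)

lemma BijGroup_mult_apply:
  "g \<in> carrier (BijGroup S) \<Longrightarrow> h \<in> carrier (BijGroup S) \<Longrightarrow> x \<in> S \<Longrightarrow>
    (g \<otimes>\<^bsub>BijGroup S\<^esub> h) x = g (h x)"
  by (simp add: BijGroup_def compose_def)

lemma BijGroup_one_apply: "x \<in> S \<Longrightarrow> \<one>\<^bsub>BijGroup S\<^esub> x = x"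
  by (simp add: BijGroup_def)

lemma BijGroup_inv_apply:
  assumes "g \<in> carrier (BijGroup S)" "x \<in> S"
  shows "(inv\<^bsub>BijGroup S\<^esub> g) (g x) = x" "g ((inv\<^bsub>BijGroup S\<^esub> g) x) = x"
proof -
  interpret group "BijGroup S" by (rule group_BijGroup)
  show "(inv\<^bsub>BijGroup S\<^esub> g) (g x) = x" "g ((inv\<^bsub>BijGroup S\<^esub> g) x) = x"
    using assms BijGroup_mult_apply[of _ S _ x, symmetric] BijGroup_one_apply[of x S]
      inv_closed[OF assms(1)] l_inv[OF assms(1)] r_inv[OF assms(1)] by metis+
qed

lemma BijGroup_ext:
  assumes "g \<in> carrier (BijGroup S)" "h \<in> carrier (BijGroup S)" "\<And>x. x \<in> S \<Longrightarrow> g x = h x"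
  shows "g = h"
  using assms by (intro extensionalityI[of g S h]) (auto simp: BijGroup_def Bij_def)

lemma transitive_onD:
  "transitive_on S M \<Longrightarrow> x \<in> S \<Longrightarrow> y \<in> S \<Longrightarrow> \<exists>g \<in> M. g x = y"
  using transitive_action.unique_orbit by fastforce

section \<open>Cartesian coordinates\<close>

text \<open>
  The functions \<open>c 1, \<dots>, c l\<close> identify \<open>\<Omega>\<close> with \<open>\<Gamma>\<^sup>l\<close>. Keeping \<open>\<Omega>\<close> itself as the permuted set
  avoids carrying groups over to \<open>\<Gamma>\<^sup>l\<close>.
\<close>

locale cartesian_coordinates =
  fixes \<Omega> :: "'a set" and c :: "nat \<Rightarrow> 'a \<Rightarrow> 'b" and \<Gamma> :: "'b set" and l :: nat
  assumes coord_in: "i \<in> {1..l} \<Longrightarrow> \<omega> \<in> \<Omega> \<Longrightarrow> c i \<omega> \<in> \<Gamma>"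
    and coord_ext: "\<omega> \<in> \<Omega> \<Longrightarrow> \<omega>' \<in> \<Omega> \<Longrightarrow> (\<And>i. i \<in> {1..l} \<Longrightarrow> c i \<omega> = c i \<omega>') \<Longrightarrow> \<omega> = \<omega>'"
    and coord_ex: "(\<And>i. i \<in> {1..l} \<Longrightarrow> \<gamma> i \<in> \<Gamma>) \<Longrightarrow> \<exists>\<omega> \<in> \<Omega>. \<forall>i \<in> {1..l}. c i \<omega> = \<gamma> i"
    and two_points: "\<exists>x \<in> \<Gamma>. \<exists>y \<in> \<Gamma>. x \<noteq> y"
begin

abbreviation "B \<equiv> BijGroup \<Omega>"

text \<open>
  Being in the wreath product in product action is expressed by the equivalence relations of having
  the same \<open>i\<close>-th coordinate: the permutation \<open>x\<close> carries the \<open>i\<close>-th relation to the \<open>\<sigma> i\<close>-th. By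
  \<open>permutes_coords_unique\<close> below, \<open>\<sigma>\<close> is determined by \<open>x\<close> because \<open>\<Gamma>\<close> has two points.
\<close>

definition permutes_coords :: "('a \<Rightarrow> 'a) \<Rightarrow> (nat \<Rightarrow> nat) \<Rightarrow> bool"
  where "permutes_coords x \<sigma> \<longleftrightarrow> \<sigma> permutes {1..l} \<and>
    (\<forall>i \<in> {1..l}. \<forall>\<omega> \<in> \<Omega>. \<forall>\<omega>' \<in> \<Omega>. c (\<sigma> i) (x \<omega>) = c (\<sigma> i) (x \<omega>') \<longleftrightarrow> c i \<omega> = c i \<omega>')"

lemma permutes_coordsD:
  assumes "permutes_coords x \<sigma>" "i \<in> {1..l}" "\<omega> \<in> \<Omega>" "\<omega>' \<in> \<Omega>"
  shows "c (\<sigma> i) (x \<omega>) = c (\<sigma> i) (x \<omega>') \<longleftrightarrow> c i \<omega> = c i \<omega>'"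
  using assms unfolding permutes_coords_def by blast

lemma permutes_coords_unique:
  assumes "permutes_coords x \<sigma>" "permutes_coords x \<tau>"
  shows "\<sigma> = \<tau>"
proof
  have s: "\<sigma> permutes {1..l}" "\<tau> permutes {1..l}" using assms by (auto simp: permutes_coords_def)
  fix i
  show "\<sigma> i = \<tau> i"
  proof (cases "i \<in> {1..l}")
    case False
    then show ?thesis using s by (simp add: permutes_not_in)
  next
    case i: True
    show ?thesis
    proof (rule ccontr)
      assume ne: "\<sigma> i \<noteq> \<tau> i"
      define k where "k = inv' \<tau> (\<sigma> i)"
      have k: "\<tau> k = \<sigma> i" using permutes_inverses(1)[OF s(2)] by (simp add: k_def)
      then have "k \<noteq> i" using ne by auto
      have "k \<in> {1..l}"
        using i permutes_in_image[OF s(1)] permutes_in_image[OF permutes_inv[OF s(2)]]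
        by (simp add: k_def)
      obtain a b where ab: "a \<in> \<Gamma>" "b \<in> \<Gamma>" "a \<noteq> b" using two_points by blast
      obtain \<omega> where w: "\<omega> \<in> \<Omega>" "\<forall>j \<in> {1..l}. c j \<omega> = a" using coord_ex[of "\<lambda>_. a"] ab by blast
      obtain \<omega>' where w': "\<omega>' \<in> \<Omega>" "\<forall>j \<in> {1..l}. c j \<omega>' = (if j = k then b else a)"
        using coord_ex[of "\<lambda>j. if j = k then b else a"] ab by (meson)
      have "c i \<omega> = c i \<omega>'" "c k \<omega> \<noteq> c k \<omega>'" using w w' \<open>k \<noteq> i\<close> \<open>k \<in> {1..l}\<close> i ab by auto
      then show False
        using permutes_coordsD[OF assms(1) i w(1) w'(1)] permutes_coordsD[OF assms(2) \<open>k \<in> {1..l}\<close> w(1) w'(1)] k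
        by simp
    qed
  qed
qed

lemma permutes_coords_mult:
  assumes x: "x \<in> carrier B" "permutes_coords x \<sigma>" and y: "y \<in> carrier B" "permutes_coords y \<tau>"
  shows "permutes_coords (x \<otimes>\<^bsub>B\<^esub> y) (\<sigma> \<circ> \<tau>)"
  unfolding permutes_coords_def
proof (intro conjI ballI)
  show "\<sigma> \<circ> \<tau> permutes {1..l}" using x y by (simp add: permutes_coords_def permutes_compose)
  fix i \<omega> \<omega>' assume i: "i \<in> {1..l}" and w: "\<omega> \<in> \<Omega>" "\<omega>' \<in> \<Omega>"
  have "\<tau> i \<in> {1..l}" using y i permutes_in_image[of \<tau> "{1..l}" i] by (simp add: permutes_coords_def)
  then show "c ((\<sigma> \<circ> \<tau>) i) ((x \<otimes>\<^bsub>B\<^esub> y) \<omega>) = c ((\<sigma> \<circ> \<tau>) i) ((x \<otimes>\<^bsub>B\<^esub> y) \<omega>') \<longleftrightarrow> c i \<omega> = c i \<omega>'"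
    using permutes_coordsD[OF x(2), of "\<tau> i" "y \<omega>" "y \<omega>'"] permutes_coordsD[OF y(2) i w]
      BijGroup_maps_to[OF y(1)] BijGroup_mult_apply[OF x(1) y(1)] w by simp
qed

text \<open>
  If \<open>\<rho>\<close> were injective, then by the theorems of Lagrange and orbit-stabiliser
  \<open>|\<Gamma>|\<^sup>l = |\<Omega>|\<close> would divide \<open>|M|\<close>, and \<open>|M|\<close> would divide \<open>l!\<close>.
\<close>

lemma transitive_not_faithful_on_coords:
  assumes M: "subgroup M B" "transitive_on \<Omega> M" and l: "l \<ge> 1"
    and \<rho>: "\<rho> \<in> hom (perm_group \<Omega> M) (sym_group l)"
  shows "\<not> inj_on \<rho> M"
proof
  assume inj: "inj_on \<rho> M"
  interpret B: group B by (rule group_BijGroup)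
  interpret act: transitive_action "perm_group \<Omega> M" \<Omega> "\<lambda>g. g" by (rule M(2))
  interpret M: group "perm_group \<Omega> M" using B.subgroup_imp_group[OF M(1)] .
  interpret S: group "sym_group l" by (rule sym_group_is_group)
  interpret \<rho>: group_hom "perm_group \<Omega> M" "sym_group l" \<rho>
    using \<rho> by unfold_locales
  have finS: "finite (carrier (sym_group l))" by (simp add: sym_group_def finite_permutations)
  have cardS: "card (carrier (sym_group l)) = fact l" by (simp add: sym_group_def card_permutations)
  have "subgroup (\<rho> ` M) (sym_group l)" using \<rho>.img_is_subgroup by simp
  from S.lagrange[OF this] have "card (\<rho> ` M) dvd fact l"
    by (metis cardS dvd_triv_right order_def)
  then have M_dvd: "card M dvd fact l" using card_image[OF inj] by simp
  have finM: "finite M"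
  proof (rule inj_on_finite[OF inj _ finS])
    show "\<rho> ` M \<subseteq> carrier (sym_group l)" using \<rho>.hom_closed by auto
  qed
  obtain a where a: "a \<in> \<Gamma>" using two_points by blast
  obtain \<omega> where w: "\<omega> \<in> \<Omega>" using coord_ex[of "\<lambda>_. a"] a by blast
  have orb: "orbit (perm_group \<Omega> M) (\<lambda>g. g) \<omega> = \<Omega>"
  proof
    show "orbit (perm_group \<Omega> M) (\<lambda>g. g) \<omega> \<subseteq> \<Omega>"
      using BijGroup_maps_to[OF subgroup.mem_carrier[OF M(1)] w] by (auto simp: orbit_def)
    show "\<Omega> \<subseteq> orbit (perm_group \<Omega> M) (\<lambda>g. g) \<omega>"
      using transitive_onD[OF M(2) w] by (force simp: orbit_def)
  qed
  then have "\<Omega> = (\<lambda>g. g \<omega>) ` M" by (auto simp: orbit_def)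
  then have fin\<Omega>: "finite \<Omega>" using finM by (metis finite_imageI)
  have "card M = card \<Omega> * card (point_stabilizer \<Omega> M \<omega>)"
    using act.orbit_stabilizer_theorem[OF w] by (simp add: orb order_def)
  then have "card \<Omega> dvd card M" by simp
  moreover have "bij_betw (\<lambda>\<omega>. \<lambda>i\<in>{1..l}. c i \<omega>) \<Omega> (cartesian_power \<Gamma> l)"
    unfolding bij_betw_def
  proof
    show "inj_on (\<lambda>\<omega>. \<lambda>i\<in>{1..l}. c i \<omega>) \<Omega>"
    proof (rule inj_onI)
      fix \<omega> \<omega>' assume w: "\<omega> \<in> \<Omega>" "\<omega>' \<in> \<Omega>" and eq: "(\<lambda>i\<in>{1..l}. c i \<omega>) = (\<lambda>i\<in>{1..l}. c i \<omega>')"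
      show "\<omega> = \<omega>'" by (rule coord_ext[OF w]) (use fun_cong[OF eq] in \<open>metis restrict_apply'\<close>)
    qed
    show "(\<lambda>\<omega>. \<lambda>i\<in>{1..l}. c i \<omega>) ` \<Omega> = cartesian_power \<Gamma> l"
    proof
      show "(\<lambda>\<omega>. \<lambda>i\<in>{1..l}. c i \<omega>) ` \<Omega> \<subseteq> cartesian_power \<Gamma> l" using coord_in by fastforce
      show "cartesian_power \<Gamma> l \<subseteq> (\<lambda>\<omega>. \<lambda>i\<in>{1..l}. c i \<omega>) ` \<Omega>"
      proof
        fix \<gamma> assume g: "\<gamma> \<in> cartesian_power \<Gamma> l"
        then obtain \<omega> where "\<omega> \<in> \<Omega>" "\<forall>i \<in> {1..l}. c i \<omega> = \<gamma> i"
          using coord_ex[of \<gamma>, OF PiE_mem[OF g]] by blast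
        moreover from this have "(\<lambda>i\<in>{1..l}. c i \<omega>) = \<gamma>"
          using g by (intro extensionalityI[of _ "{1..l}"]) (auto simp: PiE_def)
        ultimately show "\<gamma> \<in> (\<lambda>\<omega>. \<lambda>i\<in>{1..l}. c i \<omega>) ` \<Omega>" by blast
      qed
    qed
  qed
  then have "card \<Omega> = card \<Gamma> ^ l"
    using bij_betw_same_card by (fastforce simp: card_PiE)
  moreover have "card \<Gamma> \<ge> 2"
  proof -
    have "\<Gamma> \<subseteq> c 1 ` \<Omega>"
    proof
      fix x assume "x \<in> \<Gamma>"
      then obtain \<omega> where "\<omega> \<in> \<Omega>" "\<forall>i \<in> {1..l}. c i \<omega> = x" using coord_ex[of "\<lambda>_. x"] by blast
      then show "x \<in> c 1 ` \<Omega>" using l by (intro image_eqI[of x "c 1" \<omega>]) auto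
    qed
    then have fin: "finite \<Gamma>" using fin\<Omega> finite_subset by blast
    obtain x y where "x \<in> \<Gamma>" "y \<in> \<Gamma>" "x \<noteq> y" using two_points by blast
    then show ?thesis using card_mono[OF fin, of "{x, y}"] by simp
  qed
  ultimately show False using power_not_dvd_fact[OF _ l, of "card \<Gamma>"] M_dvd dvd_trans by metis
qed

definition acts_only_on :: "nat \<Rightarrow> ('a \<Rightarrow> 'a) \<Rightarrow> bool"
  where "acts_only_on i x \<longleftrightarrow> (\<forall>i' \<in> {1..l} - {i}. \<forall>\<omega> \<in> \<Omega>. c i' (x \<omega>) = c i' \<omega>)"

lemma acts_only_on_conj:
  assumes g: "g \<in> carrier B" "permutes_coords g \<sigma>" and x: "x \<in> carrier B" "acts_only_on i x"
  shows "acts_only_on (\<sigma> i) (g \<otimes>\<^bsub>B\<^esub> x \<otimes>\<^bsub>B\<^esub> inv\<^bsub>B\<^esub> g)"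
  unfolding acts_only_on_def
proof (intro ballI)
  interpret B: group B by (rule group_BijGroup)
  fix i' \<omega> assume i': "i' \<in> {1..l} - {\<sigma> i}" and w: "\<omega> \<in> \<Omega>"
  have s: "\<sigma> permutes {1..l}" using g by (simp add: permutes_coords_def)
  define k where "k = inv' \<sigma> i'"
  have k: "\<sigma> k = i'" using permutes_inverses(1)[OF s] by (simp add: k_def)
  then have kl: "k \<in> {1..l} - {i}"
    using i' permutes_in_image[OF permutes_inv[OF s], of i'] by (auto simp: k_def)
  define \<omega>' where "\<omega>' = (inv\<^bsub>B\<^esub> g) \<omega>"
  have w': "\<omega>' \<in> \<Omega>" "g \<omega>' = \<omega>"
    using BijGroup_maps_to[OF B.inv_closed[OF g(1)] w] BijGroup_inv_apply(2)[OF g(1) w]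
    by (auto simp: \<omega>'_def)
  have xw': "x \<omega>' \<in> \<Omega>" using BijGroup_maps_to[OF x(1) w'(1)] .
  have "c k (x \<omega>') = c k \<omega>'" using x(2) kl w'(1) unfolding acts_only_on_def by blast
  then have "c i' (g (x \<omega>')) = c i' (g \<omega>')"
    using permutes_coordsD[OF g(2) _ xw' w'(1), of k] kl k by blast
  moreover have "(g \<otimes>\<^bsub>B\<^esub> x \<otimes>\<^bsub>B\<^esub> inv\<^bsub>B\<^esub> g) \<omega> = g (x \<omega>')"
    using g(1) x(1) w w'(1) by (simp add: BijGroup_mult_apply \<omega>'_def)
  ultimately show "c i' ((g \<otimes>\<^bsub>B\<^esub> x \<otimes>\<^bsub>B\<^esub> inv\<^bsub>B\<^esub> g) \<omega>) = c i' \<omega>" using w'(2) by simp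
qed

lemma acts_only_on_commute:
  assumes x: "x \<in> carrier B" "permutes_coords x id" "acts_only_on i x"
    and y: "y \<in> carrier B" "permutes_coords y id" "acts_only_on i' y"
    and "i \<noteq> i'"
  shows "x \<otimes>\<^bsub>B\<^esub> y = y \<otimes>\<^bsub>B\<^esub> x"
proof (rule BijGroup_ext[of _ \<Omega>])
  interpret B: group B by (rule group_BijGroup)
  show "x \<otimes>\<^bsub>B\<^esub> y \<in> carrier B" "y \<otimes>\<^bsub>B\<^esub> x \<in> carrier B" using x(1) y(1) by simp_all
  fix \<omega> assume w: "\<omega> \<in> \<Omega>"
  note wx = BijGroup_maps_to[OF x(1) w] and wy = BijGroup_maps_to[OF y(1) w]
  note wxy = BijGroup_maps_to[OF x(1) wy] and wyx = BijGroup_maps_to[OF y(1) wx]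
  have "x (y \<omega>) = y (x \<omega>)"
  proof (rule coord_ext[OF wxy wyx])
    fix a assume a: "a \<in> {1..l}"
    show "c a (x (y \<omega>)) = c a (y (x \<omega>))"
    proof (cases "a = i")
      case True
      then have "c a (y \<omega>) = c a \<omega>" "c a (y (x \<omega>)) = c a (x \<omega>)"
        using y(3) a \<open>i \<noteq> i'\<close> w wx by (auto simp: acts_only_on_def)
      then show ?thesis using permutes_coordsD[OF x(2) a wy w] by simp
    next
      case False
      then have "c a (x \<omega>) = c a \<omega>" "c a (x (y \<omega>)) = c a (y \<omega>)"
        using x(3) a w wy by (auto simp: acts_only_on_def)
      then show ?thesis using permutes_coordsD[OF y(2) a wx w] by simp
    qed
  qed
  then show "(x \<otimes>\<^bsub>B\<^esub> y) \<omega> = (y \<otimes>\<^bsub>B\<^esub> x) \<omega>" using x(1) y(1) w by (simp add: BijGroup_mult_apply)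
qed

end

section \<open>Transitive groups that respect each coordinate\<close>

locale coordinatewise_group = cartesian_coordinates \<Omega> c \<Gamma> l
  for \<Omega> :: "'a set" and c :: "nat \<Rightarrow> 'a \<Rightarrow> 'b" and \<Gamma> l +
  fixes M :: "('a \<Rightarrow> 'a) set" and \<omega>\<^sub>0 :: 'a
  assumes M_subgroup: "subgroup M (BijGroup \<Omega>)"
    and M_transitive: "transitive_on \<Omega> M"
    and M_coordinatewise: "x \<in> M \<Longrightarrow> permutes_coords x id"
    and base_point: "\<omega>\<^sub>0 \<in> \<Omega>"
begin

lemmas M_in = subgroup.mem_carrier[OF M_subgroup]
  and M_mult = subgroup.m_closed[OF M_subgroup]
  and M_inv = subgroup.m_inv_closed[OF M_subgroup]
  and M_one = subgroup.one_closed[OF M_subgroup]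
  and M_maps_to = BijGroup_maps_to[OF subgroup.mem_carrier[OF M_subgroup]]
  and M_mult_apply = BijGroup_mult_apply[OF subgroup.mem_carrier[OF M_subgroup]
    subgroup.mem_carrier[OF M_subgroup]]
  and M_inv_apply = BijGroup_inv_apply[OF subgroup.mem_carrier[OF M_subgroup]]

lemma M_group: "group (perm_group \<Omega> M)"
  using group.subgroup_imp_group[OF group_BijGroup M_subgroup] .

lemma M_inv_consistent: "x \<in> M \<Longrightarrow> inv\<^bsub>perm_group \<Omega> M\<^esub> x = inv\<^bsub>B\<^esub> x"
  using group.m_inv_consistent[OF group_BijGroup M_subgroup] .

lemma M_coord_iff:
  "x \<in> M \<Longrightarrow> i \<in> {1..l} \<Longrightarrow> \<omega> \<in> \<Omega> \<Longrightarrow> \<omega>' \<in> \<Omega> \<Longrightarrow> c i (x \<omega>) = c i (x \<omega>') \<longleftrightarrow> c i \<omega> = c i \<omega>'"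
  using permutes_coordsD[OF M_coordinatewise, of x i \<omega> \<omega>'] by simp

definition coord_stabilizer :: "nat \<Rightarrow> ('a \<Rightarrow> 'a) set"
  where "coord_stabilizer i = {x \<in> M. c i (x \<omega>\<^sub>0) = c i \<omega>\<^sub>0}"

lemma subgroup_coord_stabilizer:
  assumes i: "i \<in> {1..l}"
  shows "subgroup (coord_stabilizer i) (perm_group \<Omega> M)"
proof (rule group.subgroupI[OF M_group])
  show "coord_stabilizer i \<subseteq> carrier (perm_group \<Omega> M)" by (auto simp: coord_stabilizer_def)
  show "coord_stabilizer i \<noteq> {}"
    using M_one BijGroup_one_apply[OF base_point] by (auto simp: coord_stabilizer_def)
next
  fix x assume x: "x \<in> coord_stabilizer i"
  then have xM: "x \<in> M" by (simp add: coord_stabilizer_def)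
  have "c i (x ((inv\<^bsub>B\<^esub> x) \<omega>\<^sub>0)) = c i (x \<omega>\<^sub>0)"
    using x M_inv_apply(2)[OF xM base_point] by (simp add: coord_stabilizer_def)
  then have "c i ((inv\<^bsub>B\<^esub> x) \<omega>\<^sub>0) = c i \<omega>\<^sub>0"
    using M_coord_iff[OF xM i M_maps_to[OF M_inv[OF xM] base_point] base_point] by simp
  then show "inv\<^bsub>perm_group \<Omega> M\<^esub> x \<in> coord_stabilizer i"
    using M_inv[OF xM] by (simp add: M_inv_consistent[OF xM] coord_stabilizer_def)
next
  fix x y assume xy: "x \<in> coord_stabilizer i" "y \<in> coord_stabilizer i"
  then have M: "x \<in> M" "y \<in> M" by (simp_all add: coord_stabilizer_def)
  have "c i (x (y \<omega>\<^sub>0)) = c i (x \<omega>\<^sub>0)"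
    using M_coord_iff[OF M(1) i M_maps_to[OF M(2) base_point] base_point] xy
    by (simp add: coord_stabilizer_def)
  then show "x \<otimes>\<^bsub>perm_group \<Omega> M\<^esub> y \<in> coord_stabilizer i"
    using xy M_mult[OF M] M_mult_apply[OF M base_point] by (simp add: coord_stabilizer_def)
qed

text \<open>
  This is transitivity in the language of subgroups: some \<open>p\<close> in \<open>M\<close> moves \<open>\<omega>\<^sub>0\<close> to the point that
  shares coordinate \<open>i\<close> with \<open>\<omega>\<^sub>0\<close> and all others with \<open>x \<omega>\<^sub>0\<close>, and \<open>q\<close> is what is left of \<open>x\<close>.
\<close>

lemma coord_stabilizer_factorisation:
  assumes i: "i \<in> {1..l}" and xM: "x \<in> M"
  shows "\<exists>p \<in> coord_stabilizer i. \<exists>q \<in> M. x = p \<otimes>\<^bsub>B\<^esub> q \<and> (\<forall>i' \<in> {1..l} - {i}. q \<in> coord_stabilizer i')"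
proof -
  interpret B: group B by (rule group_BijGroup)
  note xw = M_maps_to[OF xM base_point]
  have "(if j = i then c i \<omega>\<^sub>0 else c j (x \<omega>\<^sub>0)) \<in> \<Gamma>" if "j \<in> {1..l}" for j
    using coord_in[OF i base_point] coord_in[OF that xw] by simp
  from coord_ex[of "\<lambda>j. if j = i then c i \<omega>\<^sub>0 else c j (x \<omega>\<^sub>0)", OF this]
  obtain \<omega>' where w': "\<omega>' \<in> \<Omega>"
    "\<forall>j \<in> {1..l}. c j \<omega>' = (if j = i then c i \<omega>\<^sub>0 else c j (x \<omega>\<^sub>0))" by blast
  obtain p where p: "p \<in> M" "p \<omega>\<^sub>0 = \<omega>'" using transitive_onD[OF M_transitive base_point w'(1)] by blast
  let ?q = "inv\<^bsub>B\<^esub> p \<otimes>\<^bsub>B\<^esub> x"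
  have qM: "?q \<in> M" using M_mult[OF M_inv[OF p(1)] xM] .
  have pK: "p \<in> coord_stabilizer i" using p w' i by (simp add: coord_stabilizer_def)
  have xeq: "x = p \<otimes>\<^bsub>B\<^esub> ?q"
    using M_in[OF xM] M_in[OF p(1)] by (simp add: B.m_assoc[symmetric])
  have pq: "p (?q \<omega>\<^sub>0) = x \<omega>\<^sub>0"
    using M_mult_apply[OF p(1) qM base_point] xeq by simp
  have "?q \<in> coord_stabilizer i'" if i': "i' \<in> {1..l} - {i}" for i'
  proof -
    have "c i' (p (?q \<omega>\<^sub>0)) = c i' (p \<omega>\<^sub>0)" using pq w'(2) i' p(2) by simp
    then have "c i' (?q \<omega>\<^sub>0) = c i' \<omega>\<^sub>0"
      using M_coord_iff[OF p(1) _ M_maps_to[OF qM base_point] base_point] i' by blast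
    then show ?thesis using qM by (simp add: coord_stabilizer_def)
  qed
  then show ?thesis using pK qM xeq by (intro bexI[of _ p] bexI[of _ ?q]) auto
qed

text \<open>
  Conjugation by \<open>M\<close> carries the stabiliser of the \<open>i\<close>-th coordinate of \<open>\<omega>\<^sub>0\<close> to that of any other
  value, because \<open>M\<close> is transitive.
\<close>

lemma conj_closed_in_coord_stabilizer_trivial:
  assumes i: "i \<in> {1..l}" and F: "F \<subseteq> coord_stabilizer i"
    and conj: "\<And>x y. x \<in> F \<Longrightarrow> y \<in> M \<Longrightarrow> y \<otimes>\<^bsub>B\<^esub> x \<otimes>\<^bsub>B\<^esub> inv\<^bsub>B\<^esub> y \<in> F"
    and x: "x \<in> F" and w: "\<omega> \<in> \<Omega>"
  shows "c i (x \<omega>) = c i \<omega>"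
proof -
  interpret B: group B by (rule group_BijGroup)
  obtain y where y: "y \<in> M" "y \<omega>\<^sub>0 = \<omega>" using transitive_onD[OF M_transitive base_point w] by blast
  have xM: "x \<in> M" using x F by (auto simp: coord_stabilizer_def)
  let ?z = "inv\<^bsub>B\<^esub> y \<otimes>\<^bsub>B\<^esub> x \<otimes>\<^bsub>B\<^esub> y"
  have "?z \<in> F" using conj[OF x M_inv[OF y(1)]] M_in[OF y(1)] by simp
  then have zK: "?z \<in> coord_stabilizer i" and zM: "?z \<in> M" using F by (auto simp: coord_stabilizer_def)
  have "y \<otimes>\<^bsub>B\<^esub> ?z = x \<otimes>\<^bsub>B\<^esub> y"
    using M_in[OF xM] M_in[OF y(1)] by (simp add: B.m_assoc[symmetric])
  then have "y (?z \<omega>\<^sub>0) = x \<omega>"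
    using M_mult_apply[OF y(1) zM base_point] M_mult_apply[OF xM y(1) base_point] y(2) by simp
  moreover have "c i (y (?z \<omega>\<^sub>0)) = c i (y \<omega>\<^sub>0)"
    using M_coord_iff[OF y(1) i M_maps_to[OF zM base_point] base_point] zK
    by (simp add: coord_stabilizer_def)
  ultimately show ?thesis using y(2) by simp
qed

definition axis :: "nat \<Rightarrow> ('a \<Rightarrow> 'a) set"
  where "axis i = {x \<in> M. acts_only_on i x}"

lemma axis_one: "\<one>\<^bsub>B\<^esub> \<in> axis i"
  using M_one by (auto simp: axis_def acts_only_on_def BijGroup_one_apply)

lemma axis_mult: "x \<in> axis i \<Longrightarrow> y \<in> axis i \<Longrightarrow> x \<otimes>\<^bsub>B\<^esub> y \<in> axis i"
  using M_maps_to M_mult by (auto simp: axis_def acts_only_on_def M_mult_apply)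

lemma axis_inv:
  assumes "x \<in> axis i"
  shows "inv\<^bsub>B\<^esub> x \<in> axis i"
proof -
  have xM: "x \<in> M" using assms by (simp add: axis_def)
  have "c i' ((inv\<^bsub>B\<^esub> x) \<omega>) = c i' \<omega>" if "i' \<in> {1..l} - {i}" "\<omega> \<in> \<Omega>" for i' \<omega>
  proof -
    have "c i' (x ((inv\<^bsub>B\<^esub> x) \<omega>)) = c i' ((inv\<^bsub>B\<^esub> x) \<omega>)"
      using assms that M_maps_to[OF M_inv[OF xM] that(2)] by (simp add: axis_def acts_only_on_def)
    then show ?thesis using M_inv_apply(2)[OF xM that(2)] by simp
  qed
  then show ?thesis using M_inv[OF xM] by (simp add: axis_def acts_only_on_def)
qed

text \<open>
  This is the internal direct product of the subgroups \<open>axis i\<close>: the components of an element are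
  characterised by their actions, which avoids products indexed by coordinates in the group \<open>M\<close>.
\<close>

definition axis_product :: "('a \<Rightarrow> 'a) set"
  where "axis_product = {x \<in> M. \<forall>i \<in> {1..l}. \<exists>y \<in> axis i. \<forall>\<omega> \<in> \<Omega>. c i (y \<omega>) = c i (x \<omega>)}"

lemma axis_subset_axis_product: "axis a \<subseteq> axis_product"
proof
  fix x assume x: "x \<in> axis a"
  have "\<exists>y \<in> axis i. \<forall>\<omega> \<in> \<Omega>. c i (y \<omega>) = c i (x \<omega>)" if i: "i \<in> {1..l}" for i
  proof (cases "a = i")
    case True
    then show ?thesis using x by blast
  next
    case False
    then have "\<forall>\<omega> \<in> \<Omega>. c i (\<one>\<^bsub>B\<^esub> \<omega>) = c i (x \<omega>)"
      using x i by (simp add: axis_def acts_only_on_def BijGroup_one_apply)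
    then show ?thesis using axis_one by blast
  qed
  then show "x \<in> axis_product" using x by (simp add: axis_product_def axis_def)
qed

text \<open>
  A group that permutes the coordinates and normalises \<open>M\<close> permutes the subgroups \<open>axis i\<close>.
\<close>

lemma axis_product_normal:
  assumes G: "subgroup G B" "\<And>g. g \<in> G \<Longrightarrow> \<exists>\<sigma>. permutes_coords g \<sigma>"
    and M: "M \<lhd> perm_group \<Omega> G"
  shows "axis_product \<lhd> perm_group \<Omega> G"
proof -
  interpret B: group B by (rule group_BijGroup)
  interpret G: group "perm_group \<Omega> G" using B.subgroup_imp_group[OF G(1)] .
  note G_in = subgroup.mem_carrier[OF G(1)]
  have MG: "M \<subseteq> G" using subgroup.subset[OF normal_imp_subgroup[OF M]] by simp
  have M_conj: "g \<otimes>\<^bsub>B\<^esub> x \<otimes>\<^bsub>B\<^esub> inv\<^bsub>B\<^esub> g \<in> M" if "g \<in> G" "x \<in> M" for g x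
    using normal.inv_op_closed2[OF M, of g x] that B.m_inv_consistent[OF G(1) that(1)] by simp
  have PM: "x \<in> M" if "x \<in> axis_product" for x using that by (simp add: axis_product_def)
  have component: "\<exists>y \<in> axis i. \<forall>\<omega> \<in> \<Omega>. c i (y \<omega>) = c i (x \<omega>)" if "x \<in> axis_product" "i \<in> {1..l}" for x i
    using that by (simp add: axis_product_def)
  have P_intro: "x \<in> axis_product"
    if "x \<in> M" "\<And>i. i \<in> {1..l} \<Longrightarrow> \<exists>y \<in> axis i. \<forall>\<omega> \<in> \<Omega>. c i (y \<omega>) = c i (x \<omega>)" for x
    using that by (simp add: axis_product_def)
  have P_one: "\<one>\<^bsub>B\<^esub> \<in> axis_product" using axis_subset_axis_product axis_one by blast
  have P_inv: "inv\<^bsub>B\<^esub> x \<in> axis_product" if x: "x \<in> axis_product" for x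
  proof (rule P_intro)
    note xM = PM[OF x]
    show "inv\<^bsub>B\<^esub> x \<in> M" using M_inv[OF xM] .
    fix i assume i: "i \<in> {1..l}"
    obtain y where y: "y \<in> axis i" "\<forall>\<omega> \<in> \<Omega>. c i (y \<omega>) = c i (x \<omega>)" using component[OF x i] by blast
    then have yM: "y \<in> M" by (simp add: axis_def)
    have "c i ((inv\<^bsub>B\<^esub> y) \<omega>) = c i ((inv\<^bsub>B\<^esub> x) \<omega>)" if w: "\<omega> \<in> \<Omega>" for \<omega>
    proof -
      note xw = M_maps_to[OF M_inv[OF xM] w] and yw = M_maps_to[OF M_inv[OF yM] w]
      have "c i (y ((inv\<^bsub>B\<^esub> y) \<omega>)) = c i (x ((inv\<^bsub>B\<^esub> x) \<omega>))"
        using M_inv_apply(2)[OF xM w] M_inv_apply(2)[OF yM w] by simp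
      also have "\<dots> = c i (y ((inv\<^bsub>B\<^esub> x) \<omega>))" using y(2) xw by simp
      finally show ?thesis using M_coord_iff[OF yM i yw xw] by simp
    qed
    then show "\<exists>y \<in> axis i. \<forall>\<omega> \<in> \<Omega>. c i (y \<omega>) = c i ((inv\<^bsub>B\<^esub> x) \<omega>)" using axis_inv[OF y(1)] by blast
  qed
  have P_mult: "x \<otimes>\<^bsub>B\<^esub> z \<in> axis_product" if x: "x \<in> axis_product" and z: "z \<in> axis_product" for x z
  proof (rule P_intro)
    note xM = PM[OF x] and zM = PM[OF z]
    show "x \<otimes>\<^bsub>B\<^esub> z \<in> M" using M_mult[OF xM zM] .
    fix i assume i: "i \<in> {1..l}"
    obtain x' z' where x': "x' \<in> axis i" "\<forall>\<omega> \<in> \<Omega>. c i (x' \<omega>) = c i (x \<omega>)"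
      and z': "z' \<in> axis i" "\<forall>\<omega> \<in> \<Omega>. c i (z' \<omega>) = c i (z \<omega>)"
      using component[OF x i] component[OF z i] by blast
    then have M': "x' \<in> M" "z' \<in> M" by (simp_all add: axis_def)
    have "c i ((x' \<otimes>\<^bsub>B\<^esub> z') \<omega>) = c i ((x \<otimes>\<^bsub>B\<^esub> z) \<omega>)" if w: "\<omega> \<in> \<Omega>" for \<omega>
    proof -
      have "c i (x' (z' \<omega>)) = c i (x (z' \<omega>))" using x'(2) M_maps_to[OF M'(2) w] by blast
      also have "\<dots> = c i (x (z \<omega>))"
        using M_coord_iff[OF xM i M_maps_to[OF M'(2) w] M_maps_to[OF zM w]] z'(2) w by blast
      finally show ?thesis using M_mult_apply[OF M' w] M_mult_apply[OF xM zM w] by simp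
    qed
    then show "\<exists>y \<in> axis i. \<forall>\<omega> \<in> \<Omega>. c i (y \<omega>) = c i ((x \<otimes>\<^bsub>B\<^esub> z) \<omega>)"
      using axis_mult[OF x'(1) z'(1)] by blast
  qed
  have P_conj: "g \<otimes>\<^bsub>B\<^esub> x \<otimes>\<^bsub>B\<^esub> inv\<^bsub>B\<^esub> g \<in> axis_product" if g: "g \<in> G" and x: "x \<in> axis_product" for g x
  proof (rule P_intro)
    note xM = PM[OF x] and gB = G_in[OF g]
    show "g \<otimes>\<^bsub>B\<^esub> x \<otimes>\<^bsub>B\<^esub> inv\<^bsub>B\<^esub> g \<in> M" using M_conj[OF g xM] .
    fix i assume i: "i \<in> {1..l}"
    obtain \<sigma> where s: "permutes_coords g \<sigma>" using G(2)[OF g] by blast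
    then have perm: "\<sigma> permutes {1..l}" by (simp add: permutes_coords_def)
    define k where "k = inv' \<sigma> i"
    have k: "\<sigma> k = i" "k \<in> {1..l}"
      using permutes_inverses(1)[OF perm] permutes_in_image[OF permutes_inv[OF perm], of i] i
      by (simp_all add: k_def)
    obtain y where y: "y \<in> axis k" "\<forall>\<omega> \<in> \<Omega>. c k (y \<omega>) = c k (x \<omega>)" using component[OF x k(2)] by blast
    then have yM: "y \<in> M" and "acts_only_on k y" by (simp_all add: axis_def)
    then have conj: "g \<otimes>\<^bsub>B\<^esub> y \<otimes>\<^bsub>B\<^esub> inv\<^bsub>B\<^esub> g \<in> axis i"
      using acts_only_on_conj[OF gB s M_in[OF yM]] M_conj[OF g yM] k(1) by (auto simp: axis_def)
    have "c i ((g \<otimes>\<^bsub>B\<^esub> y \<otimes>\<^bsub>B\<^esub> inv\<^bsub>B\<^esub> g) \<omega>) = c i ((g \<otimes>\<^bsub>B\<^esub> x \<otimes>\<^bsub>B\<^esub> inv\<^bsub>B\<^esub> g) \<omega>)" if w: "\<omega> \<in> \<Omega>" for \<omega>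
    proof -
      define \<omega>' where "\<omega>' = (inv\<^bsub>B\<^esub> g) \<omega>"
      have w': "\<omega>' \<in> \<Omega>" using BijGroup_maps_to[OF B.inv_closed[OF gB] w] by (simp add: \<omega>'_def)
      have val: "(g \<otimes>\<^bsub>B\<^esub> u \<otimes>\<^bsub>B\<^esub> inv\<^bsub>B\<^esub> g) \<omega> = g (u \<omega>')" if "u \<in> M" for u
        using M_in[OF that] gB w w' by (simp add: BijGroup_mult_apply \<omega>'_def)
      have "c k (y \<omega>') = c k (x \<omega>')" using y(2) w' by blast
      then show ?thesis
        using permutes_coordsD[OF s k(2) M_maps_to[OF yM w'] M_maps_to[OF xM w']] k(1) val[OF yM] val[OF xM]
        by simp
    qed
    then show "\<exists>y \<in> axis i. \<forall>\<omega> \<in> \<Omega>. c i (y \<omega>) = c i ((g \<otimes>\<^bsub>B\<^esub> x \<otimes>\<^bsub>B\<^esub> inv\<^bsub>B\<^esub> g) \<omega>)" using conj by blast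
  qed
  have "subgroup axis_product (perm_group \<Omega> G)"
  proof (rule G.subgroupI)
    show "axis_product \<subseteq> carrier (perm_group \<Omega> G)" "axis_product \<noteq> {}"
      using PM MG P_one by auto
    show "inv\<^bsub>perm_group \<Omega> G\<^esub> x \<in> axis_product" if "x \<in> axis_product" for x
      using P_inv[OF that] B.m_inv_consistent[OF G(1), of x] PM[OF that] MG by auto
  qed (simp add: P_mult)
  then show ?thesis
    unfolding G.normal_inv_iff using P_conj B.m_inv_consistent[OF G(1)] by simp
qed

text \<open>
  If \<open>M\<close> is a power of a nonabelian simple group with full diagonal point stabiliser \<open>D\<close>, one
  factor acts on a single coordinate only. So \<open>axis_product\<close> is not trivial, and by minimality it is
  \<open>M\<close>. Then \<open>D\<close> decomposes along the coordinates as well, and being simple it lies in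
  one \<open>axis i\<close>. But elements of different axes commute and \<open>D\<close> has trivial centraliser,
  so \<open>M\<close> acts trivially on every coordinate other than \<open>i\<close>, against transitivity.
\<close>

lemma not_diagonal_power:
  assumes G: "subgroup G B" "\<And>g. g \<in> G \<Longrightarrow> \<exists>\<sigma>. permutes_coords g \<sigma>"
    and min: "minimal_normal M (perm_group \<Omega> G)"
    and l: "l \<ge> 2" and J: "J \<noteq> {}"
  shows "\<not> diagonal_power (perm_group \<Omega> M) (point_stabilizer \<Omega> M \<omega>\<^sub>0) J \<delta>"
proof
  assume diag: "diagonal_power (perm_group \<Omega> M) (point_stabilizer \<Omega> M \<omega>\<^sub>0) J \<delta>"
  interpret B: group B by (rule group_BijGroup)
  define D where "D = point_stabilizer \<Omega> M \<omega>\<^sub>0"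
  interpret M: diagonal_power "perm_group \<Omega> M" D J \<delta> using diag by (simp add: D_def)
  have D_iff: "x \<in> D \<longleftrightarrow> x \<in> M \<and> x \<omega>\<^sub>0 = \<omega>\<^sub>0" for x by (auto simp: D_def stabilizer_def)

  have D_sub: "D \<subseteq> coord_stabilizer i" for i by (auto simp: D_iff coord_stabilizer_def)
  have fac: "\<exists>p \<in> coord_stabilizer i. \<exists>q \<in> carrier (perm_group \<Omega> M).
      x = p \<otimes>\<^bsub>perm_group \<Omega> M\<^esub> q \<and> (\<forall>i' \<in> {1..l} - {i}. q \<in> coord_stabilizer i')"
    if "i \<in> {1..l}" "x \<in> carrier (perm_group \<Omega> M)" for i x
    using coord_stabilizer_factorisation that by simp
  obtain j where j: "j \<in> J" "\<And>i i'. i \<in> {1..l} \<Longrightarrow> i' \<in> {1..l} \<Longrightarrow> i \<noteq> i' \<Longrightarrow>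
      M.factor j \<subseteq> coord_stabilizer i \<or> M.factor j \<subseteq> coord_stabilizer i'"
    by (rule M.factor_in_all_but_one[OF J, of "{1..l}" coord_stabilizer,
          OF subgroup_coord_stabilizer D_sub fac]) blast+
  have factor_M: "x \<in> M" if "x \<in> M.factor j" for x using that by (simp add: M.factor_def)
  have factor_conj: "y \<otimes>\<^bsub>B\<^esub> x \<otimes>\<^bsub>B\<^esub> inv\<^bsub>B\<^esub> y \<in> M.factor j" if "x \<in> M.factor j" "y \<in> M" for x y
    using M.factor_conj[OF that(1), of y] M_inv_consistent[OF that(2)] that(2) by simp
  have factor_triv: "c i (x \<omega>) = c i \<omega>"
    if "i \<in> {1..l}" "M.factor j \<subseteq> coord_stabilizer i" "x \<in> M.factor j" "\<omega> \<in> \<Omega>" for i x \<omega>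
    using conj_closed_in_coord_stabilizer_trivial[OF that(1,2) factor_conj that(3,4)] .
  have "\<exists>i. M.factor j \<subseteq> axis i"
  proof (cases "\<exists>i \<in> {1..l}. \<not> M.factor j \<subseteq> coord_stabilizer i")
    case True
    then obtain i where i: "i \<in> {1..l}" "\<not> M.factor j \<subseteq> coord_stabilizer i" by blast
    then have "M.factor j \<subseteq> coord_stabilizer i'" if "i' \<in> {1..l} - {i}" for i'
      using j(2)[OF i(1), of i'] that by blast
    then have "M.factor j \<subseteq> axis i"
      using factor_triv factor_M by (auto simp: axis_def acts_only_on_def)
    then show ?thesis ..
  next
    case False
    \<comment> \<open>Here every coordinate would do.\<close>
    then have "M.factor j \<subseteq> axis 1"
      using factor_triv factor_M by (auto simp: axis_def acts_only_on_def)
    then show ?thesis ..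
  qed
  then have "M.factor j \<subseteq> axis_product" using axis_subset_axis_product by blast
  then have "axis_product \<noteq> {\<one>\<^bsub>B\<^esub>}" using M.factor_nontrivial[OF j(1)] by auto
  moreover have "axis_product \<subseteq> M" by (auto simp: axis_product_def)
  moreover have "axis_product \<lhd> perm_group \<Omega> G"
    using axis_product_normal[OF G] min by (simp add: minimal_normal_def)
  ultimately have prod: "axis_product = M"
    using min unfolding minimal_normal_def by auto
  have component: "\<exists>y \<in> axis i. \<forall>\<omega> \<in> \<Omega>. c i (y \<omega>) = c i (x \<omega>)" if "x \<in> M" "i \<in> {1..l}" for x i
  proof -
    have "x \<in> axis_product" using prod that(1) by simp
    then show ?thesis using that(2) by (simp add: axis_product_def)
  qed

  obtain d where d: "d \<in> D" "d \<noteq> \<one>\<^bsub>B\<^esub>" using M.diagonal_nontrivial by auto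
  have dM: "d \<in> M" "d \<omega>\<^sub>0 = \<omega>\<^sub>0" using d by (auto simp: D_iff)
  obtain i \<omega> where i: "i \<in> {1..l}" and w: "\<omega> \<in> \<Omega>" "c i (d \<omega>) \<noteq> c i \<omega>"
  proof -
    have "\<exists>\<omega> \<in> \<Omega>. d \<omega> \<noteq> \<omega>"
      using BijGroup_ext[OF M_in[OF dM(1)] B.one_closed] d(2) by (auto simp: BijGroup_one_apply)
    then show thesis using that coord_ext M_maps_to[OF dM(1)] by metis
  qed
  \<comment> \<open>The component of \<open>d\<close> on a coordinate that \<open>d\<close> moves is a nontrivial element of \<open>D \<inter> axis i\<close>.\<close>
  obtain y where y: "y \<in> axis i" "\<forall>\<omega> \<in> \<Omega>. c i (y \<omega>) = c i (d \<omega>)" using component[OF dM(1) i] by blast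
  have yM: "y \<in> M" using y by (simp add: axis_def)
  have "y \<omega>\<^sub>0 = \<omega>\<^sub>0"
  proof (rule coord_ext[OF M_maps_to[OF yM base_point] base_point])
    fix a assume "a \<in> {1..l}"
    then show "c a (y \<omega>\<^sub>0) = c a \<omega>\<^sub>0"
      using y base_point dM(2) by (cases "a = i") (auto simp: axis_def acts_only_on_def)
  qed
  then have yD: "y \<in> D \<inter> axis i" using yM y by (simp add: D_iff)
  have y1: "y \<noteq> \<one>\<^bsub>B\<^esub>" using y(2) w by (auto simp: BijGroup_one_apply)
  have "D \<inter> axis i = D"
  proof (rule M.normal_in_diagonal_trivial_or_all)
    show "subgroup (D \<inter> axis i) (perm_group \<Omega> M)"
    proof (rule M.subgroupI)
      show "D \<inter> axis i \<subseteq> carrier (perm_group \<Omega> M)" "D \<inter> axis i \<noteq> {}" using yD by (auto simp: axis_def)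
      show "inv\<^bsub>perm_group \<Omega> M\<^esub> x \<in> D \<inter> axis i" if "x \<in> D \<inter> axis i" for x
        using that axis_inv subgroup.m_inv_closed[OF M.subgroup_diagonal, of x] M_inv_consistent[of x]
        by (auto simp: D_iff)
      show "x \<otimes>\<^bsub>perm_group \<Omega> M\<^esub> z \<in> D \<inter> axis i" if "x \<in> D \<inter> axis i" "z \<in> D \<inter> axis i" for x z
        using that axis_mult subgroup.m_closed[OF M.subgroup_diagonal, of x z] by auto
    qed
    fix e x assume e: "e \<in> D" and x: "x \<in> D \<inter> axis i"
    then have eM: "e \<in> M" and xM: "x \<in> M" by (auto simp: D_iff)
    have "acts_only_on i (e \<otimes>\<^bsub>B\<^esub> x \<otimes>\<^bsub>B\<^esub> inv\<^bsub>B\<^esub> e)"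
      using acts_only_on_conj[OF M_in[OF eM] M_coordinatewise[OF eM] M_in[OF xM], of i] x
      by (simp add: axis_def)
    moreover have "e \<otimes>\<^bsub>B\<^esub> x \<otimes>\<^bsub>B\<^esub> inv\<^bsub>B\<^esub> e \<in> D"
      using subgroup.m_closed[OF M.subgroup_diagonal] subgroup.m_inv_closed[OF M.subgroup_diagonal e]
        e x M_inv_consistent[OF eM] by simp
    ultimately show "e \<otimes>\<^bsub>perm_group \<Omega> M\<^esub> x \<otimes>\<^bsub>perm_group \<Omega> M\<^esub> inv\<^bsub>perm_group \<Omega> M\<^esub> e \<in> D \<inter> axis i"
      using M_inv_consistent[OF eM] by (auto simp: axis_def D_iff)
  next
    show "D \<inter> axis i \<noteq> {\<one>\<^bsub>perm_group \<Omega> M\<^esub>}" using yD y1 by auto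
  qed simp
  then have D_axis: "D \<subseteq> axis i" by blast

  define i' :: nat where "i' = (if i = 1 then 2 else 1)"
  have i': "i' \<in> {1..l}" "i' \<noteq> i" using l by (auto simp: i'_def)
  have axis_triv: "x = \<one>\<^bsub>B\<^esub>" if x: "x \<in> axis i'" for x
  proof -
    have xM: "x \<in> M" using x by (simp add: axis_def)
    have "x \<otimes>\<^bsub>B\<^esub> e = e \<otimes>\<^bsub>B\<^esub> x" if "e \<in> D" for e
    proof (rule acts_only_on_commute[OF M_in[OF xM] M_coordinatewise[OF xM] _ _ _ _ i'(2)])
      have "e \<in> M" "e \<in> axis i" using that D_axis by (auto simp: D_iff)
      then show "e \<in> carrier B" "permutes_coords e id" "acts_only_on i e" "acts_only_on i' x"
        using M_in M_coordinatewise x by (auto simp: axis_def)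
    qed
    then show ?thesis using M.centralizer_diagonal_trivial[of x] xM by simp
  qed
  obtain a b where ab: "a \<in> \<Gamma>" "b \<in> \<Gamma>" "a \<noteq> b" using two_points by blast
  obtain \<alpha> where \<alpha>: "\<alpha> \<in> \<Omega>" "\<forall>j \<in> {1..l}. c j \<alpha> = a" using coord_ex[of "\<lambda>_. a"] ab(1) by blast
  obtain \<beta> where \<beta>: "\<beta> \<in> \<Omega>" "\<forall>j \<in> {1..l}. c j \<beta> = b" using coord_ex[of "\<lambda>_. b"] ab(2) by blast
  obtain x where x: "x \<in> M" "x \<alpha> = \<beta>" using transitive_onD[OF M_transitive \<alpha>(1) \<beta>(1)] by blast
  obtain z where z: "z \<in> axis i'" "\<forall>\<omega> \<in> \<Omega>. c i' (z \<omega>) = c i' (x \<omega>)" using component[OF x(1) i'(1)] by blast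
  then have "c i' \<alpha> = c i' \<beta>"
    using axis_triv[OF z(1)] \<alpha>(1) x(2) BijGroup_one_apply[OF \<alpha>(1)] by metis
  then show False using \<alpha>(2) \<beta>(2) i'(1) ab(3) by auto
qed

end

section \<open>Groups of simple diagonal type\<close>

context cartesian_coordinates
begin

text \<open>
  The kernel of the action of \<open>G\<close> on the coordinates meets the minimal normal subgroup \<open>M\<close> in \<open>{\<one>}\<close> or
  in \<open>M\<close>. In the first case \<open>M\<close> embeds in the symmetric group of degree \<open>l\<close>, in the second it
  preserves every coordinate.
\<close>

lemma not_simple_diagonal_type:
  assumes G: "simple_diagonal_type \<Omega> G" "\<And>g. g \<in> G \<Longrightarrow> \<exists>\<sigma>. permutes_coords g \<sigma>"
    and l: "l \<ge> 2"
  shows False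
proof -
  obtain M \<omega> where diag: "diagonal_type_at \<Omega> G M \<omega>"
    and simple: "is_simple (perm_group \<Omega> (point_stabilizer \<Omega> M \<omega>))"
    using G(1) by (auto simp: simple_diagonal_type_def)
  then obtain k T h where qp: "quasiprimitive \<Omega> G" and min: "minimal_normal M (perm_group \<Omega> G)"
    and w: "\<omega> \<in> \<Omega>" and k: "(k :: nat) \<ge> 1"
    and T: "\<forall>i \<in> {1..k}. is_simple (T i) \<and> \<not> comm_group (T i :: ('a \<Rightarrow> 'a) monoid)"
    and h: "h \<in> iso (perm_group \<Omega> M) (product_group {1..k} T)"
    and sub: "subdirect {1..k} T (h ` point_stabilizer \<Omega> M \<omega>)"
    unfolding diagonal_type_at_def by blast
  have G_sub: "subgroup G B" and M_norm: "M \<lhd> perm_group \<Omega> G" and M_ne: "M \<noteq> {\<one>\<^bsub>B\<^esub>}"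
    using qp min by (auto simp: quasiprimitive_def minimal_normal_def)
  have M_trans: "transitive_on \<Omega> M"
    using qp M_norm M_ne by (simp add: quasiprimitive_def)
  interpret B: group B by (rule group_BijGroup)
  interpret G: group "perm_group \<Omega> G" using B.subgroup_imp_group[OF G_sub] .
  have M_subG: "subgroup M (perm_group \<Omega> G)" using M_norm by (rule normal_imp_subgroup)
  then have M_sub: "subgroup M B" and MG: "M \<subseteq> G"
    using B.incl_subgroup[OF G_sub] subgroup.subset by fastforce+
  interpret S: group "sym_group l" by (rule sym_group_is_group)
  define \<rho> where "\<rho> g = (SOME \<sigma>. permutes_coords g \<sigma>)" for g
  have \<rho>: "permutes_coords g (\<rho> g)" if "g \<in> G" for g
    unfolding \<rho>_def using G(2)[OF that] by (rule someI_ex)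
  have hom: "\<rho> \<in> hom (perm_group \<Omega> G) (sym_group l)"
  proof (rule homI)
    show "\<rho> g \<in> carrier (sym_group l)" if "g \<in> carrier (perm_group \<Omega> G)" for g
      using \<rho>[of g] that by (simp add: permutes_coords_def sym_group_carrier)
    fix x y assume "x \<in> carrier (perm_group \<Omega> G)" "y \<in> carrier (perm_group \<Omega> G)"
    then have xy: "x \<in> G" "y \<in> G" by simp_all
    note inB = subgroup.mem_carrier[OF G_sub]
    show "\<rho> (x \<otimes>\<^bsub>perm_group \<Omega> G\<^esub> y) = \<rho> x \<otimes>\<^bsub>sym_group l\<^esub> \<rho> y"
      using permutes_coords_unique[OF \<rho>[OF subgroup.m_closed[OF G_sub xy]]
          permutes_coords_mult[OF inB[OF xy(1)] \<rho>[OF xy(1)] inB[OF xy(2)] \<rho>[OF xy(2)]]]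
      by (simp add: sym_group_mult)
  qed
  interpret \<rho>: group_hom "perm_group \<Omega> G" "sym_group l" \<rho> using hom by unfold_locales
  have "kernel (perm_group \<Omega> G) (sym_group l) \<rho> \<inter> M \<lhd> perm_group \<Omega> G"
    using G.normal_subgroup_intersect[OF \<rho>.normal_kernel M_norm] .
  then consider (trivial) "kernel (perm_group \<Omega> G) (sym_group l) \<rho> \<inter> M = {\<one>\<^bsub>B\<^esub>}"
    | (all) "kernel (perm_group \<Omega> G) (sym_group l) \<rho> \<inter> M = M"
    using min unfolding minimal_normal_def by auto
  then show False
  proof cases
    case trivial
    have homM: "\<rho> \<in> hom (perm_group \<Omega> M) (sym_group l)"
      using hom MG by (auto simp: hom_def)
    have "group_hom (perm_group \<Omega> M) (sym_group l) \<rho>"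
      using homM B.subgroup_imp_group[OF M_sub] S.is_group by (simp add: group_hom_def group_hom_axioms_def)
    moreover have "kernel (perm_group \<Omega> M) (sym_group l) \<rho> = {\<one>\<^bsub>perm_group \<Omega> M\<^esub>}"
      using trivial MG by (auto simp: kernel_def)
    ultimately have "inj_on \<rho> M" using group_hom.trivial_ker_imp_inj by fastforce
    then show False using transitive_not_faithful_on_coords[OF M_sub M_trans _ homM] l by simp
  next
    case all
    have id: "permutes_coords x id" if "x \<in> M" for x
    proof -
      have "\<rho> x = id" using all that by (auto simp: kernel_def sym_group_one)
      then show ?thesis using \<rho>[of x] that MG by auto
    qed
    interpret act: transitive_action "perm_group \<Omega> M" \<Omega> "\<lambda>g. g" by (rule M_trans)
    have dp: "diagonal_power (perm_group \<Omega> M) (point_stabilizer \<Omega> M \<omega>) {1..k}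
        (\<lambda>i x. inv_into (point_stabilizer \<Omega> M \<omega>) (\<lambda>d. h d i) (h x i))"
    proof (rule simple_subdirect_imp_diagonal_power[OF _ _ _ _ _ _ _ h sub])
      show "group (perm_group \<Omega> M)" using B.subgroup_imp_group[OF M_sub] .
      show "subgroup (point_stabilizer \<Omega> M \<omega>) (perm_group \<Omega> M)" using act.stabilizer_subgroup[OF w] .
      show "is_simple (perm_group \<Omega> M\<lparr>carrier := point_stabilizer \<Omega> M \<omega>\<rparr>)" using simple by simp
    qed (use T k in auto)
    interpret coordinatewise_group \<Omega> c \<Gamma> l M \<omega>
      by (intro coordinatewise_group.intro coordinatewise_group_axioms.intro cartesian_coordinates_axioms)
        (fact M_sub M_trans id w)+
    have "{1..k} \<noteq> {}" using k by simp
    from not_diagonal_power[OF G_sub G(2) min l this] dp show False by blast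
  qed
qed

end

theorem theorem1p1:
  fixes \<Omega> :: "'a set" and G H :: "('a \<Rightarrow> 'a) set" and \<Gamma> :: "'b set" and l :: nat
  assumes "simple_diagonal_type \<Omega> G"
    and "\<exists>x \<in> \<Gamma>. \<exists>y \<in> \<Gamma>. x \<noteq> y"
    and "l \<ge> 2"
    and "subgroup H (BijGroup \<Omega>)"
    and "perm_isomorphic \<Omega> H (cartesian_power \<Gamma> l) (wreath_product_action \<Gamma> l)"
  shows "\<not> G \<subseteq> H"
proof
  assume GH: "G \<subseteq> H"
  obtain f \<phi> where f: "bij_betw f \<Omega> (cartesian_power \<Gamma> l)"
    and \<phi>: "\<phi> \<in> iso (perm_group \<Omega> H) (perm_group (cartesian_power \<Gamma> l) (wreath_product_action \<Gamma> l))"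
    and equiv: "\<forall>\<omega> \<in> \<Omega>. \<forall>a \<in> H. f (a \<omega>) = \<phi> a (f \<omega>)"
    using assms(5) by (auto simp: perm_isomorphic_def)
  have f_in: "f \<omega> \<in> cartesian_power \<Gamma> l" if "\<omega> \<in> \<Omega>" for \<omega> using f that by (auto simp: bij_betw_def)
  interpret cartesian_coordinates \<Omega> "\<lambda>i \<omega>. f \<omega> i" \<Gamma> l
  proof
    show "f \<omega> i \<in> \<Gamma>" if "i \<in> {1..l}" "\<omega> \<in> \<Omega>" for i \<omega> using PiE_mem[OF f_in[OF that(2)] that(1)] .
    show "\<omega> = \<omega>'" if "\<omega> \<in> \<Omega>" "\<omega>' \<in> \<Omega>" "\<And>i. i \<in> {1..l} \<Longrightarrow> f \<omega> i = f \<omega>' i" for \<omega> \<omega>'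
      using PiE_ext[OF f_in[OF that(1)] f_in[OF that(2)] that(3)] f that(1,2)
      by (auto simp: bij_betw_def dest: inj_onD)
    show "\<exists>\<omega> \<in> \<Omega>. \<forall>i \<in> {1..l}. f \<omega> i = \<gamma> i" if "\<And>i. i \<in> {1..l} \<Longrightarrow> \<gamma> i \<in> \<Gamma>" for \<gamma>
    proof -
      have "restrict \<gamma> {1..l} \<in> f ` \<Omega>" using f that by (simp add: bij_betw_def)
      then obtain \<omega> where "\<omega> \<in> \<Omega>" "f \<omega> = restrict \<gamma> {1..l}" by auto
      then show ?thesis by (intro bexI[of _ \<omega>]) auto
    qed
  qed (fact assms(2))
  have "\<exists>\<sigma>. permutes_coords a \<sigma>" if "a \<in> G" for a
  proof -
    have aH: "a \<in> H" using that GH by blast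
    then have "\<phi> a \<in> wreath_product_action \<Gamma> l" using \<phi> by (auto simp: iso_def hom_def)
    then obtain g \<sigma> where a: "\<phi> a = product_action \<Gamma> l g \<sigma>"
      and g: "g \<in> carrier (product_group {1..l} (\<lambda>_. BijGroup \<Gamma>))" and s: "\<sigma> \<in> carrier (sym_group l)"
      by (auto simp: wreath_product_action_def)
    have "permutes_coords a \<sigma>"
      unfolding permutes_coords_def
    proof (intro conjI ballI)
      show "\<sigma> permutes {1..l}" using s by (simp add: sym_group_carrier)
      fix i \<omega> \<omega>' assume i: "i \<in> {1..l}" and w: "\<omega> \<in> \<Omega>" "\<omega>' \<in> \<Omega>"
      have val: "f (a \<omega>) (\<sigma> i) = g i (f \<omega> i)" if "\<omega> \<in> \<Omega>" for \<omega>
        using equiv that aH f_in[OF that] sym_group_in(2)[OF s i] sym_group_in(4)[OF s]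
        by (simp add: a product_action_def)
      have "g i \<in> Bij \<Gamma>" using PiE_mem[of g "{1..l}" "\<lambda>_. Bij \<Gamma>" i] g i by (simp add: BijGroup_def)
      then have "inj_on (g i) \<Gamma>" by (simp add: Bij_def bij_betw_def)
      then show "f (a \<omega>) (\<sigma> i) = f (a \<omega>') (\<sigma> i) \<longleftrightarrow> f \<omega> i = f \<omega>' i"
        using val[OF w(1)] val[OF w(2)] coord_in[OF i w(1)] coord_in[OF i w(2)] by (simp add: inj_on_eq_iff)
    qed
    then show ?thesis by blast
  qed
  then show False using not_simple_diagonal_type[OF assms(1) _ assms(3)] by blast
qed

end
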